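(* Let $\mathcal{H}$ be a Hilbert space. The metrics $d$ and $d_{\mathrm{row}}$ are equivalent on unital C*-algebras contained in $\mathbb{B}(\mathcal{H})$. In particular, if $A,B\subseteq\mathbb{B}(\mathcal{H})$ are unital C*-algebras, then $$d_{\mathrm{row}}(A,B)\le 220\, d(A,B).$$
   Context: For a C*-algebra $C$ and closed linear subspaces $X,Y\subseteq C$, with $X_1,Y_1$ denoting their closed unit balls, the Kadison–Kastler distance is $$d(X,Y)=\max\Big\{\sup_{y\in Y_1}\inf_{x\in X_1}\|x-y\|,\ \sup_{x\in X_1}\inf_{y\in Y_1}\|x-y\|\Big\}.$$ The row distance is $$d_{\mathrm{row}}(X,Y)=\sup_{n\in\mathbb{N}}d(M_{1,n}(X),M_{1,n}(Y)),$$ where $M_{1,n}(X)$ and $M_{1,n}(Y)$ are regarded as closed linear subspaces of the C*-algebra $M_n(C)$ (rows placed in the first row). Here $C=\mathbb{B}(\mathcal{H})$. Equivalence of metrics means that each is bounded by a constant multiple of the other. *)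

theory Defs
  imports "HOL-Analysis.Analysis" "HOL-Library.Function_Algebras"
begin

text \<open>Complex Hilbert spaces; the inner product is linear in its first argument.\<close>

class complex_hilbert_space = banach +
  fixes scaleC :: "complex \<Rightarrow> 'a \<Rightarrow> 'a"
    and cinner :: "'a \<Rightarrow> 'a \<Rightarrow> complex"
  assumes scaleC_add_right: "scaleC a (x + y) = scaleC a x + scaleC a y"
    and scaleC_add_left: "scaleC (a + b) x = scaleC a x + scaleC b x"
    and scaleC_scaleC: "scaleC a (scaleC b x) = scaleC (a * b) x"
    and scaleR_scaleC: "scaleR r x = scaleC (complex_of_real r) x"
    and cinner_commute: "cinner x y = cnj (cinner y x)"
    and cinner_add_left: "cinner (x + y) z = cinner x z + cinner y z"
    and cinner_scaleC_left: "cinner (scaleC a x) y = a * cinner x y"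
    and cinner_self: "cinner x x = complex_of_real ((norm x)\<^sup>2)"

text \<open>
  \<open>'h \<Rightarrow>\<^sub>L 'h\<close> is the library's type of bounded \<^emph>\<open>real\<close>-linear operators;
  \<open>BH\<close> cuts out the complex-linear ones. The operator norm is the same over either field.
\<close>

definition BH :: "('h::complex_hilbert_space \<Rightarrow>\<^sub>L 'h) set" where
  "BH = {T. \<forall>c x. blinfun_apply T (scaleC c x) = scaleC c (blinfun_apply T x)}"

definition scale_op :: "complex \<Rightarrow> ('h::complex_hilbert_space \<Rightarrow>\<^sub>L 'h) \<Rightarrow> ('h \<Rightarrow>\<^sub>L 'h)" where
  "scale_op c T = Blinfun (\<lambda>x. scaleC c (blinfun_apply T x))"

lemma norm_scaleC: "norm (scaleC c (x::'h::complex_hilbert_space)) = cmod c * norm x"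
proof -
  have "complex_of_real ((norm (scaleC c x))\<^sup>2) = cinner (scaleC c x) (scaleC c x)" by (simp add: cinner_self)
  also have "\<dots> = c * cnj (cinner (scaleC c x) x)" by (metis cinner_scaleC_left cinner_commute)
  also have "\<dots> = (c * cnj c) * cnj (cinner x x)" by (simp add: cinner_scaleC_left)
  also have "\<dots> = complex_of_real ((cmod c * norm x)\<^sup>2)"
    by (simp add: cinner_self complex_norm_square[symmetric] power_mult_distrib)
  finally have "(norm (scaleC c x))\<^sup>2 = (cmod c * norm x)\<^sup>2" using of_real_eq_iff by blast
  then show ?thesis by (simp add: power2_eq_iff_nonneg)
qed

lemma scale_op_apply: "blinfun_apply (scale_op c T) x = scaleC c (blinfun_apply T x)"
proof -
  have "bounded_linear (\<lambda>x. scaleC c (blinfun_apply T x))"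
  proof (rule bounded_linear_intro[where K="cmod c * norm T"])
    show "norm (scaleC c (blinfun_apply T x)) \<le> norm x * (cmod c * norm T)" for x
      using mult_left_mono[OF norm_blinfun[of T x], of "cmod c"] by (simp add: norm_scaleC mult_ac)
    show "scaleC c (blinfun_apply T (r *\<^sub>R x)) = r *\<^sub>R scaleC c (blinfun_apply T x)" for r x
      unfolding blinfun.scaleR_right unfolding scaleR_scaleC scaleC_scaleC by (simp add: mult.commute)
  qed (simp add: blinfun.add_right scaleC_add_right)
  then show ?thesis by (simp add: scale_op_def bounded_linear_Blinfun_apply)
qed

definition is_adjoint ::
    "('h::complex_hilbert_space \<Rightarrow>\<^sub>L 'h) \<Rightarrow> ('h \<Rightarrow>\<^sub>L 'h) \<Rightarrow> bool" where
  "is_adjoint T S \<longleftrightarrow>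
     (\<forall>x y. cinner (blinfun_apply T x) y = cinner x (blinfun_apply S y))"

definition cstar_subalgebra :: "('h::complex_hilbert_space \<Rightarrow>\<^sub>L 'h) set \<Rightarrow> bool" where
  "cstar_subalgebra A \<longleftrightarrow>
     A \<subseteq> BH \<and> 0 \<in> A \<and>
     (\<forall>S\<in>A. \<forall>T\<in>A. S + T \<in> A) \<and>
     (\<forall>c. \<forall>T\<in>A. scale_op c T \<in> A) \<and>
     (\<forall>S\<in>A. \<forall>T\<in>A. S o\<^sub>L T \<in> A) \<and>
     (\<forall>T\<in>A. \<exists>S\<in>A. is_adjoint T S) \<and>
     closed A"

text \<open>The unit of \<open>A\<close> is not required to be the identity operator of the Hilbert space.\<close>

definition unital_cstar_subalgebra :: "('h::complex_hilbert_space \<Rightarrow>\<^sub>L 'h) set \<Rightarrow> bool" where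
  "unital_cstar_subalgebra A \<longleftrightarrow>
     cstar_subalgebra A \<and> (\<exists>e\<in>A. \<forall>T\<in>A. e o\<^sub>L T = T \<and> T o\<^sub>L e = T)"

text \<open>
  The Kadison--Kastler distance relative to a norm \<open>N\<close>. The norm is a parameter because the
  distance is also needed for \<open>n \<times> n\<close> matrices over the bounded operators with variable \<open>n\<close>, which
  do not form a single normed type. For linear subspaces all suprema and infima below are over
  nonempty sets and bounded, with values in \<open>[0, 1]\<close>.
\<close>

definition unit_ball :: "('c \<Rightarrow> real) \<Rightarrow> 'c set \<Rightarrow> 'c set" where
  "unit_ball N X = {x \<in> X. N x \<le> 1}"

definition kk_dist :: "('c::ab_group_add \<Rightarrow> real) \<Rightarrow> 'c set \<Rightarrow> 'c set \<Rightarrow> real" where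
  "kk_dist N X Y =
     max (SUP y\<in>unit_ball N Y. INF x\<in>unit_ball N X. N (x - y))
         (SUP x\<in>unit_ball N X. INF y\<in>unit_ball N Y. N (x - y))"

definition d_KK ::
    "('h::complex_hilbert_space \<Rightarrow>\<^sub>L 'h) set \<Rightarrow> ('h \<Rightarrow>\<^sub>L 'h) set \<Rightarrow> real" where
  "d_KK X Y = kk_dist norm X Y"

text \<open>
  An \<open>n \<times> n\<close> operator matrix is a function of indices \<open>i, j < n\<close>. Its C*-norm is the norm of
  the operator \<open>h \<mapsto> (\<Sum>j. T i j (h j))\<^sub>i\<close> on the \<open>n\<close>-fold Hilbert direct sum.
\<close>

definition mat_norm :: "nat \<Rightarrow> (nat \<Rightarrow> nat \<Rightarrow> ('h::complex_hilbert_space \<Rightarrow>\<^sub>L 'h)) \<Rightarrow> real" where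
  "mat_norm n T =
     (SUP h\<in>{h. (\<Sum>j<n. (norm (h j))\<^sup>2) \<le> 1}.
        sqrt (\<Sum>i<n. (norm (\<Sum>j<n. blinfun_apply (T i j) (h j)))\<^sup>2))"

definition row_space ::
    "nat \<Rightarrow> ('h::complex_hilbert_space \<Rightarrow>\<^sub>L 'h) set \<Rightarrow> (nat \<Rightarrow> nat \<Rightarrow> ('h \<Rightarrow>\<^sub>L 'h)) set" where
  "row_space n X =
     {T. (\<forall>j<n. T 0 j \<in> X) \<and> (\<forall>i j. i \<noteq> 0 \<or> j \<ge> n \<longrightarrow> T i j = 0)}"

definition d_row ::
    "('h::complex_hilbert_space \<Rightarrow>\<^sub>L 'h) set \<Rightarrow> ('h \<Rightarrow>\<^sub>L 'h) set \<Rightarrow> real" where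
  "d_row X Y = (SUP n\<in>{1..}. kk_dist (mat_norm n) (row_space n X) (row_space n Y))"

definition equivalent_dists_on :: "'s set \<Rightarrow> ('s \<Rightarrow> 's \<Rightarrow> real) \<Rightarrow> ('s \<Rightarrow> 's \<Rightarrow> real) \<Rightarrow> bool" where
  "equivalent_dists_on S d1 d2 \<longleftrightarrow>
     (\<exists>c>0. \<forall>x\<in>S. \<forall>y\<in>S. d1 x y \<le> c * d2 x y) \<and>
     (\<exists>c>0. \<forall>x\<in>S. \<forall>y\<in>S. d2 x y \<le> c * d1 x y)"

end

theory Submission
  imports Defs
begin

text \<open>
  Taking adjoints turns rows into columns \<open>x\<close>, that is, \<open>\<Sum>\<^sub>i \<parallel>x\<^sub>i v\<parallel>\<^sup>2 \<le> \<parallel>v\<parallel>\<^sup>2\<close>. A perturbed polar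
  decomposition \<open>x\<^sub>i = w\<^sub>i h\<^sub>i\<close> with \<open>\<parallel>w\<^sub>i\<parallel> \<le> 1\<close> reduces the approximation of columns to self-adjoint
  columns \<open>h\<close>, because the contractions \<open>w\<^sub>i\<close> may be approximated one at a time.
  For self-adjoint \<open>h\<close> a truncation argument for noncommutative Rademacher sums applies. The random sum
  \<open>s = \<Sum>\<^sub>i \<epsilon>\<^sub>i h\<^sub>i\<close> has fourth moment \<open>E \<parallel>s\<^sup>2 v\<parallel>\<^sup>2 \<le> 3 \<parallel>v\<parallel>\<^sup>2\<close>, so it splits as \<open>s = f + (s - f)\<close> with
  \<open>\<parallel>f\<parallel> \<le> 1\<close> and \<open>E \<parallel>(s - f) v\<parallel>\<^sup>2 \<le> 3/16 \<parallel>v\<parallel>\<^sup>2\<close>. Each value of \<open>f\<close> is close to some \<open>b\<close> in the other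
  algebra, Bessel's inequality for the signs shows that the elements \<open>E \<epsilon>\<^sub>i b\<close> approximate \<open>h\<^sub>i\<close> as a
  column, and the remainder, again a self-adjoint column but of smaller norm, is treated recursively.
\<close>

section \<open>The underlying real Hilbert space\<close>

text \<open>Library operators are real-linear and only real scalars occur below, so the real part of
  the inner product suffices; it induces the same norm.\<close>

definition ip :: "'h::complex_hilbert_space \<Rightarrow> 'h \<Rightarrow> real" where
  "ip x y = Re (cinner x y)"

lemma ip_commute: "ip x y = ip y x"
  unfolding ip_def by (subst cinner_commute) simp

lemma ip_add_left: "ip (x + y) z = ip x z + ip y z"
  by (simp add: ip_def cinner_add_left)

lemma ip_add_right: "ip x (y + z) = ip x y + ip x z"
  by (simp add: ip_commute[of x] ip_add_left)

lemma ip_scaleR_left: "ip (r *\<^sub>R x) y = r * ip x y"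
  by (simp add: ip_def scaleR_scaleC cinner_scaleC_left)

lemma ip_scaleR_right: "ip x (r *\<^sub>R y) = r * ip x y"
  by (simp add: ip_commute[of x] ip_scaleR_left)

lemma ip_minus_left: "ip (- x) y = - ip x y"
  using ip_scaleR_left[of "-1" x y] by simp

lemma ip_diff_left: "ip (x - y) z = ip x z - ip y z"
  using ip_add_left[of x "- y" z] by (simp add: ip_minus_left)

lemma ip_diff_right: "ip x (y - z) = ip x y - ip x z"
  by (simp add: ip_commute[of x] ip_diff_left)

lemma ip_zero_left [simp]: "ip 0 x = 0"
  using ip_scaleR_left[of 0 0 x] by simp

lemma ip_zero_right [simp]: "ip x 0 = 0"
  by (simp add: ip_commute[of x])

lemma ip_self: "ip x x = (norm x)\<^sup>2"
  unfolding ip_def cinner_self by simp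

lemmas ip_simps = ip_add_left ip_add_right ip_diff_left ip_diff_right ip_scaleR_left ip_scaleR_right

lemma ip_sum_left: "ip (\<Sum>i\<in>I. f i) y = (\<Sum>i\<in>I. ip (f i) y)"
  by (induction I rule: infinite_finite_induct) (auto simp: ip_add_left)

lemma norm_add_sq: "(norm (x + y))\<^sup>2 = (norm x)\<^sup>2 + 2 * ip x y + (norm y)\<^sup>2"
  by (simp add: ip_self[symmetric] ip_simps ip_commute[of y x])

lemma norm_diff_sq: "(norm (x - y))\<^sup>2 = (norm x)\<^sup>2 - 2 * ip x y + (norm y)\<^sup>2"
  by (simp add: ip_self[symmetric] ip_simps ip_commute[of y x])

lemma parallelogram:
  "(norm (x + y))\<^sup>2 + (norm (x - y))\<^sup>2 = 2 * (norm x)\<^sup>2 + 2 * (norm (y::'h::complex_hilbert_space))\<^sup>2"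
  by (simp add: norm_add_sq norm_diff_sq)

lemma norm_add_sq_le: "(norm (x + y))\<^sup>2 \<le> 2 * (norm x)\<^sup>2 + 2 * (norm (y::'h::complex_hilbert_space))\<^sup>2"
  using parallelogram[of x y] by (smt (verit) zero_le_power2)

lemma ip_le_sq: "2 * ip x y \<le> (norm x)\<^sup>2 + (norm y)\<^sup>2"
  using norm_diff_sq[of x y] by (smt (verit) zero_le_power2)

lemma ip_le_norm: "ip x y \<le> norm x * norm y"
proof (cases "x = 0 \<or> y = 0")
  case False
  define u v where "u = (1 / norm x) *\<^sub>R x" and "v = (1 / norm y) *\<^sub>R y"
  have "norm u = 1" "norm v = 1" using False by (auto simp: u_def v_def)
  then have "ip u v \<le> 1" using ip_le_sq[of u v] by simp
  then show ?thesis using False by (simp add: u_def v_def ip_simps field_simps)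
qed auto

section \<open>Random signs\<close>

text \<open>The binary digits of \<open>k < 2 ^ n\<close> enumerate all sign vectors of length \<open>n\<close>.\<close>

definition rsign :: "nat \<Rightarrow> nat \<Rightarrow> real" where
  "rsign i k = (- 1) ^ (k div 2 ^ i)"

lemma rsign_low: "k < 2 ^ n \<Longrightarrow> rsign n k = 1"
  by (simp add: rsign_def)

lemma rsign_high: "k < 2 ^ n \<Longrightarrow> rsign n (2 ^ n + k) = - 1"
  by (simp add: rsign_def div_add_self1)

lemma rsign_shift:
  assumes "i < n"
  shows "rsign i (2 ^ n + k) = rsign i k"
proof -
  obtain d where n: "n = Suc d + i" using assms by (metis less_natE add.commute add_Suc_right)
  have "(2 ^ n + k) div 2 ^ i = 2 * 2 ^ d + k div (2::nat) ^ i"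
    using div_mult_self3[of "2 ^ i" "2 * 2 ^ d" k] by (simp add: n power_add mult.assoc)
  then show ?thesis by (simp add: rsign_def power_add power_mult)
qed

text \<open>Splits off the top digit: \<open>k\<close> and \<open>2 ^ n + k\<close> carry the same
  signs below \<open>n\<close> and opposite signs at \<open>n\<close>. The inductions on the number
  of signs rest on this pairing.\<close>

lemma sum_pow2_Suc:
  fixes F :: "nat \<Rightarrow> 'b::comm_monoid_add"
  shows "(\<Sum>k<2 ^ Suc n. F k) = (\<Sum>k<2 ^ n. F k + F (2 ^ n + k))"
proof -
  have "(\<Sum>k<2 ^ Suc n. F k) = (\<Sum>k\<in>{0..<2 ^ n}. F k) + (\<Sum>k\<in>{2 ^ n..<2 ^ n + 2 ^ n}. F k)"
    by (simp add: lessThan_atLeast0 sum.atLeastLessThan_concat mult_2)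
  also have "(\<Sum>k\<in>{2 ^ n..<2 ^ n + 2 ^ n}. F k) = (\<Sum>k\<in>{0..<2 ^ n}. F (2 ^ n + k))"
    using sum.shift_bounds_nat_ivl[of F 0 "2 ^ n" "2 ^ n"] by (simp add: add.commute)
  finally show ?thesis by (simp add: lessThan_atLeast0 sum.distrib)
qed

section \<open>Rademacher sums: orthogonality, Bessel's inequality and moments\<close>

definition rsum :: "nat \<Rightarrow> (nat \<Rightarrow> 'b::real_vector) \<Rightarrow> nat \<Rightarrow> 'b" where
  "rsum n v k = (\<Sum>i<n. rsign i k *\<^sub>R v i)"

lemma rsum_low: "k < 2 ^ n \<Longrightarrow> rsum (Suc n) v k = rsum n v k + v n"
  by (simp add: rsum_def rsign_low)

lemma rsum_high: "k < 2 ^ n \<Longrightarrow> rsum (Suc n) v (2 ^ n + k) = rsum n v k - v n"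
  by (simp add: rsum_def rsign_high rsign_shift)

lemma rsum_blinfun: "blinfun_apply (rsum n h k) x = rsum n (\<lambda>i. blinfun_apply (h i) x) k"
  by (simp add: rsum_def blinfun.sum_left blinfun.scaleR_left)

lemma blinfun_rsum: "blinfun_apply T (rsum n v k) = rsum n (\<lambda>i. blinfun_apply T (v i)) k"
  by (simp add: rsum_def blinfun.sum_right blinfun.scaleR_right)

text \<open>The parallelogram law for the pair obtained by adding and subtracting \<open>v n\<close>
  cancels the cross terms.\<close>

lemma rsum_orthogonal:
  fixes v :: "nat \<Rightarrow> 'h::complex_hilbert_space"
  shows "(\<Sum>k<2 ^ n. (norm (rsum n v k))\<^sup>2) = 2 ^ n * (\<Sum>i<n. (norm (v i))\<^sup>2)"
proof (induction n)
  case (Suc n)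
  have "(\<Sum>k<2 ^ Suc n. (norm (rsum (Suc n) v k))\<^sup>2)
      = (\<Sum>k<2 ^ n. 2 * (norm (rsum n v k))\<^sup>2 + 2 * (norm (v n))\<^sup>2)"
    unfolding sum_pow2_Suc by (rule sum.cong) (simp_all add: rsum_low rsum_high parallelogram)
  then show ?case by (simp add: sum.distrib sum_distrib_left[symmetric] Suc algebra_simps)
qed (simp add: rsum_def)

text \<open>The signs are orthonormal, so averaging against \<open>rsign i\<close> recovers the
  coefficient of index \<open>i\<close>.\<close>

lemma rsum_reconstruct:
  assumes "i < n"
  shows "(\<Sum>k<2 ^ n. rsign i k *\<^sub>R rsum n v k) = (2 ^ n) *\<^sub>R (v i :: 'b::real_vector)"
  using assms
proof (induction n)
  case (Suc n)
  show ?case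
  proof (cases "i = n")
    case True
    have "(\<Sum>k<2 ^ Suc n. rsign i k *\<^sub>R rsum (Suc n) v k) = (\<Sum>k<(2::nat) ^ n. 2 *\<^sub>R v n)"
      unfolding sum_pow2_Suc True
      by (rule sum.cong) (simp_all add: rsum_low rsum_high rsign_low rsign_high scaleR_2)
    then show ?thesis by (simp add: True sum_constant_scaleR mult.commute del: sum_constant)
  next
    case False
    then have i: "i < n" using Suc.prems by simp
    have "(\<Sum>k<2 ^ Suc n. rsign i k *\<^sub>R rsum (Suc n) v k)
        = (\<Sum>k<2 ^ n. rsign i k *\<^sub>R rsum n v k + rsign i k *\<^sub>R rsum n v k)"
      unfolding sum_pow2_Suc
      by (rule sum.cong)
        (simp_all add: rsum_low rsum_high rsign_shift i scaleR_add_right scaleR_diff_right)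
    also have "\<dots> = (2 ^ Suc n) *\<^sub>R v i"
      by (simp only: sum.distrib Suc.IH[OF i]) (simp add: scaleR_add_left[symmetric])
    finally show ?thesis .
  qed
qed simp

lemma norm_sum_sq_le:
  fixes v :: "nat \<Rightarrow> 'b::real_normed_vector"
  shows "(norm (\<Sum>k<N. v k))\<^sup>2 \<le> real N * (\<Sum>k<N. (norm (v k))\<^sup>2)"
proof -
  have "(norm (\<Sum>k<N. v k))\<^sup>2 \<le> (\<Sum>k<N. norm (v k))\<^sup>2"
    by (intro power_mono norm_sum) simp
  also have "\<dots> \<le> (\<Sum>k<N. (norm (v k))\<^sup>2) * real N"
    using Cauchy_Schwarz_ineq_sum[of "\<lambda>k. norm (v k)" "\<lambda>_. 1" "{..<N}"] by simp
  finally show ?thesis by (simp add: mult.commute)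
qed

text \<open>Bessel's inequality for vector-valued functions of the sign vector. After splitting off
  the top digit, the lower signs see only the sums \<open>p\<close> and the top sign only the
  differences \<open>q\<close>; the parallelogram law adds the two contributions.\<close>

lemma rsign_bessel:
  fixes z :: "nat \<Rightarrow> 'h::complex_hilbert_space"
  shows "(\<Sum>i<n. (norm (\<Sum>k<2 ^ n. rsign i k *\<^sub>R z k))\<^sup>2) \<le> 2 ^ n * (\<Sum>k<2 ^ n. (norm (z k))\<^sup>2)"
proof (induction n arbitrary: z)
  case (Suc n)
  define p q where "p = (\<lambda>k. z k + z (2 ^ n + k))" and "q = (\<lambda>k. z k - z (2 ^ n + k))"
  have "(\<Sum>k<2 ^ Suc n. rsign i k *\<^sub>R z k) = (\<Sum>k<2 ^ n. rsign i k *\<^sub>R p k)" if "i < n" for i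
    unfolding sum_pow2_Suc p_def by (rule sum.cong) (simp_all add: rsign_shift that scaleR_add_right)
  moreover have "(\<Sum>k<2 ^ Suc n. rsign n k *\<^sub>R z k) = (\<Sum>k<2 ^ n. q k)"
    unfolding sum_pow2_Suc q_def by (rule sum.cong) (simp_all add: rsign_low rsign_high)
  ultimately have "(\<Sum>i<Suc n. (norm (\<Sum>k<2 ^ Suc n. rsign i k *\<^sub>R z k))\<^sup>2)
      = (\<Sum>i<n. (norm (\<Sum>k<2 ^ n. rsign i k *\<^sub>R p k))\<^sup>2) + (norm (\<Sum>k<2 ^ n. q k))\<^sup>2"
    by simp
  also have "\<dots> \<le> 2 ^ n * (\<Sum>k<2 ^ n. (norm (p k))\<^sup>2) + 2 ^ n * (\<Sum>k<2 ^ n. (norm (q k))\<^sup>2)"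
    using Suc.IH[of p] norm_sum_sq_le[of q "2 ^ n"] by simp
  also have "\<dots> = 2 ^ n * (\<Sum>k<2 ^ n. (norm (p k))\<^sup>2 + (norm (q k))\<^sup>2)"
    by (simp add: sum.distrib algebra_simps)
  also have "\<dots> = 2 ^ Suc n * (\<Sum>k<2 ^ Suc n. (norm (z k))\<^sup>2)"
    unfolding sum_pow2_Suc p_def q_def parallelogram
    by (simp add: sum.distrib sum_distrib_left[symmetric] distrib_left)
  finally show ?case .
qed simp

lemma rsum_square:
  fixes h :: "nat \<Rightarrow> 'h::real_normed_vector \<Rightarrow>\<^sub>L 'h"
  shows "(\<Sum>k<2 ^ n. rsum n h k (rsum n h k x)) = (2 ^ n) *\<^sub>R (\<Sum>i<n. h i (h i x))"
proof (induction n)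
  case (Suc n)
  have "(\<Sum>k<2 ^ Suc n. rsum (Suc n) h k (rsum (Suc n) h k x))
      = (\<Sum>k<2 ^ n. 2 *\<^sub>R rsum n h k (rsum n h k x) + 2 *\<^sub>R h n (h n x))"
    unfolding sum_pow2_Suc
    by (rule sum.cong)
      (simp_all add: rsum_low rsum_high blinfun.add_left blinfun.diff_left blinfun.add_right
        blinfun.diff_right scaleR_2)
  then show ?case
    by (simp add: sum.distrib scaleR_sum_right[symmetric] Suc sum_constant_scaleR scaleR_add_right
        mult.commute del: sum_constant)
qed (simp add: rsum_def)

text \<open>With \<open>g = h n\<close>, the squares of s + g and s - g are P + Q and P - Q, where P
  = s^2 + g^2 and Q = s g + g s. The parallelogram law removes the products of P and Q,
  \<open>rsum_square\<close> averages the mixed term of P, and \<open>rsum_orthogonal\<close>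
  averages both halves of Q.\<close>

lemma rsum_fourth_moment:
  fixes h :: "nat \<Rightarrow> 'h::complex_hilbert_space \<Rightarrow>\<^sub>L 'h"
  shows "(\<Sum>k<2 ^ n. (norm (rsum n h k (rsum n h k x)))\<^sup>2)
    \<le> 2 ^ n * ((norm (\<Sum>i<n. h i (h i x)))\<^sup>2 + 2 * (\<Sum>i<n. \<Sum>j<n. (norm (h i (h j x)))\<^sup>2))"
proof (induction n)
  case (Suc n)
  define s S g where "s = rsum n h" and "S = (\<Sum>i<n. h i (h i x))" and "g = h n"
  have step: "(norm (rsum (Suc n) h k (rsum (Suc n) h k x)))\<^sup>2
      + (norm (rsum (Suc n) h (2 ^ n + k) (rsum (Suc n) h (2 ^ n + k) x)))\<^sup>2
    \<le> 2 * (norm (s k (s k x)))\<^sup>2 + 4 * ip (s k (s k x)) (g (g x)) + 2 * (norm (g (g x)))\<^sup>2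
      + 4 * (norm (s k (g x)))\<^sup>2 + 4 * (norm (g (s k x)))\<^sup>2" if "k < 2 ^ n" for k
  proof -
    define P Q where "P = s k (s k x) + g (g x)" and "Q = s k (g x) + g (s k x)"
    have "rsum (Suc n) h k (rsum (Suc n) h k x) = P + Q"
      by (simp add: rsum_low that P_def Q_def s_def g_def blinfun.add_left blinfun.add_right)
    moreover have "rsum (Suc n) h (2 ^ n + k) (rsum (Suc n) h (2 ^ n + k) x) = P - Q"
      by (simp add: rsum_high that P_def Q_def s_def g_def blinfun.diff_left blinfun.diff_right)
    moreover have "(norm P)\<^sup>2 = (norm (s k (s k x)))\<^sup>2 + 2 * ip (s k (s k x)) (g (g x)) + (norm (g (g x)))\<^sup>2"
      by (simp add: P_def norm_add_sq)
    moreover have "(norm Q)\<^sup>2 \<le> 2 * (norm (s k (g x)))\<^sup>2 + 2 * (norm (g (s k x)))\<^sup>2"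
      unfolding Q_def by (rule norm_add_sq_le)
    ultimately show ?thesis using parallelogram[of P Q] by simp
  qed
  have cross: "(\<Sum>k<2 ^ n. ip (s k (s k x)) (g (g x))) = 2 ^ n * ip S (g (g x))"
    unfolding ip_sum_left[symmetric] s_def rsum_square S_def ip_scaleR_left ..
  have sg: "(\<Sum>k<2 ^ n. (norm (s k (g x)))\<^sup>2) = 2 ^ n * (\<Sum>i<n. (norm (h i (g x)))\<^sup>2)"
    unfolding s_def rsum_blinfun by (rule rsum_orthogonal)
  have gs: "(\<Sum>k<2 ^ n. (norm (g (s k x)))\<^sup>2) = 2 ^ n * (\<Sum>i<n. (norm (g (h i x)))\<^sup>2)"
    unfolding s_def rsum_blinfun blinfun_rsum by (rule rsum_orthogonal)
  have "(\<Sum>k<2 ^ Suc n. (norm (rsum (Suc n) h k (rsum (Suc n) h k x)))\<^sup>2)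
     \<le> (\<Sum>k<2 ^ n. 2 * (norm (s k (s k x)))\<^sup>2 + 4 * ip (s k (s k x)) (g (g x)) + 2 * (norm (g (g x)))\<^sup>2
      + 4 * (norm (s k (g x)))\<^sup>2 + 4 * (norm (g (s k x)))\<^sup>2)"
    unfolding sum_pow2_Suc by (rule sum_mono) (use step in auto)
  also have "\<dots> = 2 * (\<Sum>k<2 ^ n. (norm (s k (s k x)))\<^sup>2)
      + 2 ^ n * (4 * ip S (g (g x)) + 2 * (norm (g (g x)))\<^sup>2
      + 4 * (\<Sum>i<n. (norm (h i (g x)))\<^sup>2) + 4 * (\<Sum>i<n. (norm (g (h i x)))\<^sup>2))"
    by (simp add: sum.distrib sum_distrib_left[symmetric] cross sg gs algebra_simps)
  \<comment> \<open>Raising the coefficient of \<open>(norm (g (g x)))\<^sup>2\<close> from 2 to 6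
    supplies the diagonal term i = j = n of the double sum.\<close>
  also have "\<dots> \<le> 2 * (2 ^ n * ((norm S)\<^sup>2 + 2 * (\<Sum>i<n. \<Sum>j<n. (norm (h i (h j x)))\<^sup>2)))
      + 2 ^ n * (4 * ip S (g (g x)) + 6 * (norm (g (g x)))\<^sup>2
      + 4 * (\<Sum>i<n. (norm (h i (g x)))\<^sup>2) + 4 * (\<Sum>i<n. (norm (g (h i x)))\<^sup>2))"
    using Suc.IH unfolding s_def S_def by (intro add_mono mult_left_mono) auto
  also have "\<dots> = 2 ^ Suc n * ((norm (S + g (g x)))\<^sup>2
      + 2 * (\<Sum>i<Suc n. \<Sum>j<Suc n. (norm (h i (h j x)))\<^sup>2))"
    by (simp add: norm_add_sq sum.distrib g_def algebra_simps)
  finally show ?case by (simp add: S_def g_def)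
qed (simp add: rsum_def)

section \<open>Functional calculus in operator algebras\<close>

text \<open>A relation rather than a function, since an adjoint is supplied only by membership in an
  algebra. It refers to the real inner product.\<close>

definition adj :: "('h::complex_hilbert_space \<Rightarrow>\<^sub>L 'h) \<Rightarrow> ('h \<Rightarrow>\<^sub>L 'h) \<Rightarrow> bool" where
  "adj T S \<longleftrightarrow> (\<forall>x y. ip (T x) y = ip x (S y))"

lemma adjD: "adj T S \<Longrightarrow> ip (T x) y = ip x (S y)"
  by (simp add: adj_def)

lemma adj_sym: "adj T S \<Longrightarrow> adj S T"
  unfolding adj_def by (metis ip_commute)

lemma adj_unique:
  assumes "adj T S" "adj T S'"
  shows "S = S'"
proof (rule blinfun_eqI)
  fix y
  have "ip (S y - S' y) (S y - S' y) = 0"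
    using adjD[OF assms(1), of "S y - S' y" y] adjD[OF assms(2), of "S y - S' y" y]
    by (simp add: ip_diff_right)
  then show "S y = S' y" by (simp add: ip_self)
qed

lemma adj_add: "adj T S \<Longrightarrow> adj T' S' \<Longrightarrow> adj (T + T') (S + S')"
  by (simp add: adj_def blinfun.add_left ip_simps)

lemma adj_diff: "adj T S \<Longrightarrow> adj T' S' \<Longrightarrow> adj (T - T') (S - S')"
  by (simp add: adj_def blinfun.diff_left ip_simps)

lemma adj_scaleR: "adj T S \<Longrightarrow> adj (r *\<^sub>R T) (r *\<^sub>R S)"
  by (simp add: adj_def blinfun.scaleR_left ip_simps)

lemma adj_compose: "adj T S \<Longrightarrow> adj T' S' \<Longrightarrow> adj (T o\<^sub>L T') (S' o\<^sub>L S)"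
  by (simp add: adj_def)

lemma adj_zero: "adj 0 0"
  by (simp add: adj_def)

lemma adj_sum: "(\<And>i. i \<in> I \<Longrightarrow> adj (T i) (S i)) \<Longrightarrow> adj (\<Sum>i\<in>I. T i) (\<Sum>i\<in>I. S i)"
  by (induction I rule: infinite_finite_induct) (auto simp: adj_add adj_zero)

lemma adj_norm_le:
  assumes "adj T S"
  shows "norm S \<le> norm T"
proof (rule norm_blinfun_bound)
  fix y
  have "norm (S y) * norm (S y) = ip (T (S y)) y"
    using adjD[OF assms, of "S y" y] by (simp add: ip_self power2_eq_square)
  also have "\<dots> \<le> norm (T (S y)) * norm y" by (rule ip_le_norm)
  also have "\<dots> \<le> norm (S y) * (norm T * norm y)"
    using mult_right_mono[OF norm_blinfun[of T "S y"], of "norm y"] by (simp add: mult_ac)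
  finally show "norm (S y) \<le> norm T * norm y"
    by (cases "norm (S y) = 0") (simp_all add: mult_le_cancel_left)
qed simp

text \<open>Real linear combinations are all that the random signs and the functional calculus use.
  The unit \<open>e\<close> may differ from the identity operator, so it takes the place of 1 in
  every formula.\<close>

locale operator_algebra =
  fixes A :: "('h::complex_hilbert_space \<Rightarrow>\<^sub>L 'h) set" and e :: "'h \<Rightarrow>\<^sub>L 'h"
  assumes zero_mem: "0 \<in> A"
    and add_mem: "S \<in> A \<Longrightarrow> T \<in> A \<Longrightarrow> S + T \<in> A"
    and scaleR_mem: "T \<in> A \<Longrightarrow> r *\<^sub>R T \<in> A"
    and compose_mem: "S \<in> A \<Longrightarrow> T \<in> A \<Longrightarrow> S o\<^sub>L T \<in> A"
    and adj_ex: "T \<in> A \<Longrightarrow> \<exists>S\<in>A. adj T S"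
    and closed_A: "closed A"
    and unit_mem: "e \<in> A"
    and unit_left': "T \<in> A \<Longrightarrow> e o\<^sub>L T = T"
    and unit_right': "T \<in> A \<Longrightarrow> T o\<^sub>L e = T"
begin

lemma diff_mem: "S \<in> A \<Longrightarrow> T \<in> A \<Longrightarrow> S - T \<in> A"
  using add_mem[OF _ scaleR_mem[of T "-1"], of S] by simp

lemma sum_mem: "(\<And>i. i \<in> I \<Longrightarrow> T i \<in> A) \<Longrightarrow> (\<Sum>i\<in>I. T i) \<in> A"
  by (induction I rule: infinite_finite_induct) (auto simp: zero_mem add_mem)

lemma unit_left: "T \<in> A \<Longrightarrow> e (T x) = T x"
  using unit_left'[of T] by (metis blinfun_apply_blinfun_compose)

lemma unit_right: "T \<in> A \<Longrightarrow> T (e x) = T x"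
  using unit_right'[of T] by (metis blinfun_apply_blinfun_compose)

text \<open>If S is the adjoint of \<open>e\<close>, then e S is self-adjoint and equals S. Hence
  \<open>e\<close> is a self-adjoint idempotent, that is, an orthogonal projection.\<close>

lemma unit_adj: "adj e e"
proof -
  obtain S where S: "S \<in> A" "adj e S" using adj_ex[OF unit_mem] by auto
  have "adj (e o\<^sub>L S) (e o\<^sub>L S)" using S adj_compose adj_sym by blast
  then have "adj S S" using unit_left'[OF S(1)] by simp
  then show ?thesis using S(2) adj_unique adj_sym by blast
qed

lemma norm_unit_le: "norm (e x) \<le> norm x"
proof -
  have "norm (e x) * norm (e x) = ip (e x) (e x)" by (simp add: ip_self power2_eq_square)
  also have "\<dots> = ip (e x) x" using adjD[OF unit_adj, of "e x" x] unit_left[OF unit_mem] by simp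
  also have "\<dots> \<le> norm (e x) * norm x" by (rule ip_le_norm)
  finally show ?thesis by (cases "norm (e x) = 0") (simp_all add: mult_le_cancel_left)
qed

section \<open>Inverses, truncation, square roots and a perturbed polar decomposition\<close>

lemma complete_A: "complete A"
  using closed_A by (simp add: complete_eq_closed)

text \<open>Banach's fixed point theorem replaces the Neumann series: k = e + (e - z) k yields a
  right inverse and l = e + l (e - z) a left inverse, both inside the complete set
  \<open>A\<close>.\<close>

lemma inverse_ex:
  assumes z: "z \<in> A" and lt: "norm (e - z) < 1"
  obtains k where "k \<in> A" "\<And>x. z (k x) = e x" "\<And>x. k (z x) = e x"
proof -
  let ?c = "norm (e - z)"
  have "\<exists>!k. k \<in> A \<and> e + ((e - z) o\<^sub>L k) = k"
  proof (rule Banach_fix[OF complete_A _ norm_ge_zero lt])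
    show "A \<noteq> {}" using zero_mem by auto
    show "(\<lambda>k. e + ((e - z) o\<^sub>L k)) ` A \<subseteq> A"
      using z by (auto intro!: add_mem compose_mem diff_mem unit_mem)
    show "dist (e + ((e - z) o\<^sub>L k)) (e + ((e - z) o\<^sub>L l)) \<le> ?c * dist k l" for k l
    proof -
      have "(e + ((e - z) o\<^sub>L k)) - (e + ((e - z) o\<^sub>L l)) = (e - z) o\<^sub>L (k - l)"
        by (rule blinfun_eqI) (simp add: blinfun.add_left blinfun.diff_left blinfun.diff_right)
      then show ?thesis unfolding dist_norm by (metis norm_blinfun_compose)
    qed
  qed
  then obtain k where k: "k \<in> A" "e + ((e - z) o\<^sub>L k) = k" by blast
  have "\<exists>!k. k \<in> A \<and> e + (k o\<^sub>L (e - z)) = k"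
  proof (rule Banach_fix[OF complete_A _ norm_ge_zero lt])
    show "A \<noteq> {}" using zero_mem by auto
    show "(\<lambda>k. e + (k o\<^sub>L (e - z))) ` A \<subseteq> A"
      using z by (auto intro!: add_mem compose_mem diff_mem unit_mem)
    show "dist (e + (k o\<^sub>L (e - z))) (e + (l o\<^sub>L (e - z))) \<le> ?c * dist k l" for k l
    proof -
      have "(e + (k o\<^sub>L (e - z))) - (e + (l o\<^sub>L (e - z))) = (k - l) o\<^sub>L (e - z)"
        by (rule blinfun_eqI) (simp add: blinfun.add_left blinfun.diff_left blinfun.diff_right)
      then show ?thesis unfolding dist_norm by (metis norm_blinfun_compose mult.commute)
    qed
  qed
  then obtain l where l: "l \<in> A" "e + (l o\<^sub>L (e - z)) = l" by blast
  have zk: "z (k x) = e x" for x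
    using arg_cong[OF k(2), of "\<lambda>T. T x"] unit_left[OF k(1)]
    by (simp add: blinfun.add_left blinfun.diff_left)
  have lz: "l (z x) = e x" for x
    using arg_cong[OF l(2), of "\<lambda>T. T x"] unit_right[OF l(1)]
    by (simp add: blinfun.add_left blinfun.diff_left blinfun.diff_right)
  \<comment> \<open>l = l e = l z k = e k = k.\<close>
  have "l x = k x" for x
    using lz[of "k x"] zk[of x] unit_right[OF l(1)] unit_left[OF k(1)] by simp
  then show thesis using that[OF k(1) zk] lz by (metis blinfun_eqI)
qed

text \<open>Expanding the square of the norm of (e - m S T) x leaves the terms - 2 m |T x|^2 and m^2
  |S T x|^2; the second is at most m |T x|^2. This estimate prepares the inversion and the square
  root below.\<close>

lemma norm_unit_minus_le:
  assumes T: "T \<in> A" and S: "adj T S" and m: "0 \<le> m" "m * (norm T)\<^sup>2 \<le> 1"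
  shows "norm (e - m *\<^sub>R (S o\<^sub>L T)) \<le> 1"
proof (rule norm_blinfun_bound)
  fix x
  have "norm (S (T x)) \<le> norm T * norm (T x)"
    using norm_blinfun[of S "T x"] mult_right_mono[OF adj_norm_le[OF S] norm_ge_zero[of "T x"]] by simp
  then have "(norm (S (T x)))\<^sup>2 \<le> (norm T)\<^sup>2 * (norm (T x))\<^sup>2"
    by (metis norm_ge_zero power_mono power_mult_distrib)
  then have "m * (norm (S (T x)))\<^sup>2 \<le> m * ((norm T)\<^sup>2 * (norm (T x))\<^sup>2)"
    using m(1) by (rule mult_left_mono)
  also have "\<dots> \<le> 1 * (norm (T x))\<^sup>2"
    using mult_right_mono[OF m(2), of "(norm (T x))\<^sup>2"] by (simp add: mult_ac)
  finally have 1: "m * (m * (norm (S (T x)))\<^sup>2) \<le> m * (norm (T x))\<^sup>2"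
    using m(1) by (intro mult_left_mono) auto
  have "ip (e x) (S (T x)) = (norm (T x))\<^sup>2"
    using adjD[OF S, of "e x" "T x"] unit_right[OF T] by (simp add: ip_self)
  then have "(norm (e x - m *\<^sub>R S (T x)))\<^sup>2
      = (norm (e x))\<^sup>2 - 2 * (m * (norm (T x))\<^sup>2) + m * (m * (norm (S (T x)))\<^sup>2)"
    unfolding norm_diff_sq ip_scaleR_right by (simp add: power_mult_distrib power2_eq_square[of m])
  also have "\<dots> \<le> (norm (e x))\<^sup>2 - m * (norm (T x))\<^sup>2" using 1 by simp
  also have "\<dots> \<le> (norm x)\<^sup>2"
    using power_mono[OF norm_unit_le[of x] norm_ge_zero, of 2] m(1) by (smt (verit) mult_nonneg_nonneg zero_le_power2)
  finally show "norm ((e - m *\<^sub>R (S o\<^sub>L T)) x) \<le> 1 * norm x"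
    by (simp add: blinfun.diff_left blinfun.scaleR_left power2_le_iff_abs_le)
qed simp

text \<open>The truncation is \<open>f = s (1 + s\<^sup>2/4)\<^sup>-\<^sup>1\<close>, for which \<open>s - f = f s\<^sup>2 / 4\<close>.\<close>

lemma truncation:
  assumes s: "s \<in> A" "adj s s"
  obtains f where "f \<in> A" "adj f f" "norm f \<le> 1" "\<And>x. norm (s x - f x) \<le> norm (s (s x)) / 4"
proof -
  \<comment> \<open>\<open>m\<close> plays the role of 1 + s^2/4. The scaling \<open>l\<close>
    satisfies 1 - l = l P / 4, so e - l m = (1 - l)(e - s^2/P) has norm at most 1 - l < 1 and l m is
    invertible.\<close>
  define P l m where "P = (norm s)\<^sup>2 + 1" and "l = 1 / (1 + P / 4)" and "m = e + (1/4) *\<^sub>R (s o\<^sub>L s)"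
  have P: "P > 0" by (simp add: P_def add_nonneg_pos)
  then have l: "0 < l" "l < 1" "1 - l = (P / 4) * l" by (simp_all add: l_def field_simps)
  have mA: "m \<in> A" unfolding m_def by (intro add_mem scaleR_mem compose_mem unit_mem s)
  have "(1 - l) * (1 / P) = l / 4" using l(3) P by simp
  then have "e - l *\<^sub>R m = (1 - l) *\<^sub>R (e - (1 / P) *\<^sub>R (s o\<^sub>L s))"
    unfolding scaleR_diff_right scaleR_scaleR
    by (simp only: m_def scaleR_add_right scaleR_scaleR scaleR_diff_left) simp
  moreover have "norm (e - (1 / P) *\<^sub>R (s o\<^sub>L s)) \<le> 1"
    by (rule norm_unit_minus_le[OF s]) (use P in \<open>auto simp: P_def field_simps\<close>)
  ultimately have "norm (e - l *\<^sub>R m) \<le> (1 - l) * 1"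
    using l by (simp only: norm_scaleR) (intro mult_mono, auto)
  then have "norm (e - l *\<^sub>R m) < 1" using l by simp
  then obtain k' where k': "k' \<in> A" "\<And>x. (l *\<^sub>R m) (k' x) = e x" "\<And>x. k' ((l *\<^sub>R m) x) = e x"
    using inverse_ex[OF scaleR_mem[OF mA]] by metis
  define k where "k = l *\<^sub>R k'"
  have k: "k \<in> A" "m (k x) = e x" "k (m x) = e x" for x
    using k' by (auto simp: k_def scaleR_mem blinfun.scaleR_left blinfun.scaleR_right)
  have mx: "m x = e x + (1/4) *\<^sub>R s (s x)" for x
    by (simp add: m_def blinfun.add_left blinfun.scaleR_left)
  \<comment> \<open>Since \<open>s\<close> commutes with \<open>m\<close>, it commutes with the
    inverse \<open>k\<close>, which makes f = s k self-adjoint.\<close>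
  have sm: "s (m x) = m (s x)" for x
    by (simp add: mx blinfun.add_right blinfun.scaleR_right unit_left s unit_right)
  have ks: "k (s x) = s (k x)" for x
  proof -
    have "k (s x) = k (s (m (k x)))" by (simp add: k unit_right s)
    also have "\<dots> = s (k x)" unfolding sm k(3) unit_left[OF s(1)] ..
    finally show ?thesis .
  qed
  have km: "adj m m"
    unfolding m_def by (intro adj_add adj_scaleR adj_compose unit_adj s)
  have kk: "adj k k"
    unfolding adj_def
  proof (intro allI)
    fix x y
    have "ip (k x) y = ip (k x) (e y)"
      using adjD[OF unit_adj, of "k x" y] by (simp add: unit_left k)
    also have "\<dots> = ip (m (k x)) (k y)" using adjD[OF km, of "k x" "k y"] by (simp add: k)
    also have "\<dots> = ip x (k y)" using adjD[OF unit_adj, of x "k y"] by (simp add: k unit_left)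
    finally show "ip (k x) y = ip x (k y)" .
  qed
  define f where "f = s o\<^sub>L k"
  have fx: "f x = s (k x)" for x by (simp add: f_def)
  have fA: "f \<in> A" unfolding f_def by (intro compose_mem s k)
  have "f = k o\<^sub>L s" by (rule blinfun_eqI) (simp add: fx ks)
  then have ff: "adj f f" using adj_compose[OF s(2) kk] f_def by simp
  \<comment> \<open>This is the scalar inequality t <= 1 + t^2/4 in operator form. With y = k x, the
    claim |s y| <= |m y| follows from |s y|^2 = <s^2 y, y> and 2 <s^2 y / 4, y> <= |s^2 y / 4|^2 +
    |y|^2.\<close>
  have nf: "norm (f x) \<le> norm x" for x
  proof -
    define y where "y = k x"
    have my: "m y = y + (1/4) *\<^sub>R s (s y)" by (simp add: mx y_def unit_left k)
    have syy: "(norm (s y))\<^sup>2 = ip (s (s y)) y"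
      using adjD[OF s(2), of "s y" y] by (simp add: ip_self)
    have "(norm (m y))\<^sup>2 = (norm y)\<^sup>2 + (1/2) * ip y (s (s y)) + (1/16) * (norm (s (s y)))\<^sup>2"
      unfolding my norm_add_sq by (simp add: ip_simps power_mult_distrib power2_eq_square)
    also have "\<dots> \<ge> (norm (s y))\<^sup>2"
    proof -
      have "2 * ip ((1/4) *\<^sub>R s (s y)) y \<le> (norm ((1/4) *\<^sub>R s (s y)))\<^sup>2 + (norm y)\<^sup>2"
        by (rule ip_le_sq)
      then show ?thesis
        using syy by (simp add: ip_simps power_mult_distrib ip_commute[of y] power2_eq_square)
    qed
    finally have "norm (s y) \<le> norm (m y)" by (simp add: power2_le_iff_abs_le)
    then show ?thesis using norm_unit_le[of x] by (simp add: fx y_def k)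
  qed
  have diff: "s x - f x = (1/4) *\<^sub>R f (s (s x))" for x
  proof -
    have "s x = s (m (k x))" by (simp add: k unit_right s)
    also have "\<dots> = f x + (1/4) *\<^sub>R s (s (s (k x)))"
      by (simp add: mx blinfun.add_right blinfun.scaleR_right fx unit_left k)
    also have "s (s (s (k x))) = f (s (s x))" by (simp add: fx ks)
    finally show ?thesis by (simp add: algebra_simps)
  qed
  show thesis
  proof (rule that[OF fA ff])
    show "norm f \<le> 1" by (rule norm_blinfun_bound) (use nf in auto)
    show "norm (s x - f x) \<le> norm (s (s x)) / 4" for x
      using nf[of "s (s x)"] by (simp add: diff)
  qed
qed

text \<open>Here \<open>e - y\<close> is the square root of \<open>e - b\<close>.\<close>

lemma sqrt_ex:
  assumes b: "b \<in> A" "adj b b" "norm b < 1"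
  obtains y where "y \<in> A" "adj y y" "norm y < 1" "y o\<^sub>L y = 2 *\<^sub>R y - b"
proof -
  \<comment> \<open>\<open>r\<close> is the smaller root of r^2 - 2 r + |b| = 0. Hence
    \<open>F\<close> maps the ball of radius \<open>r\<close> into itself and contracts it with
    factor \<open>r\<close>; a fixed point satisfies 2 y = b + y^2.\<close>
  define r where "r = 1 - sqrt (1 - norm b)"
  have r: "0 \<le> r" "r < 1" using b(3) by (auto simp: r_def real_le_lsqrt)
  have "r\<^sup>2 = 1 - 2 * sqrt (1 - norm b) + (sqrt (1 - norm b))\<^sup>2"
    by (simp add: r_def power2_diff)
  then have r2: "norm b + r\<^sup>2 = 2 * r" using b(3) by (simp add: r_def)
  define D where "D = A \<inter> cball 0 r"
  define F where "F = (\<lambda>y::'h \<Rightarrow>\<^sub>L 'h. (1/2) *\<^sub>R (b + (y o\<^sub>L y)))"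
  have D: "y \<in> D \<longleftrightarrow> y \<in> A \<and> norm y \<le> r" for y by (simp add: D_def)
  have yy: "norm (y o\<^sub>L z) \<le> r * norm z" if "norm y \<le> r" for y z :: "'h \<Rightarrow>\<^sub>L 'h"
    using norm_blinfun_compose[of y z] mult_right_mono[OF that norm_ge_zero[of z]] by linarith
  have ex: "\<exists>!y. y \<in> D \<and> F y = y"
  proof (rule Banach_fix[OF _ _ r])
    show "complete D" unfolding D_def complete_eq_closed using closed_A by (intro closed_Int) auto
    show "D \<noteq> {}" using D[of 0] zero_mem r by auto
    show "F ` D \<subseteq> D"
    proof safe
      fix y assume "y \<in> D"
      then have y: "y \<in> A" "norm y \<le> r" using D by auto
      have "norm (y o\<^sub>L y) \<le> r * r" using yy[OF y(2), of y] mult_left_mono[OF y(2) r(1)] by linarith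
      then have "norm (b + (y o\<^sub>L y)) \<le> 2 * r"
        using norm_triangle_ineq[of b "y o\<^sub>L y"] r2 by (simp add: power2_eq_square)
      then show "F y \<in> D" using y b by (simp add: D F_def scaleR_mem add_mem compose_mem)
    qed
    show "dist (F y) (F z) \<le> r * dist y z" if "y \<in> D" "z \<in> D" for y z
    proof -
      have n: "norm y \<le> r" "norm z \<le> r" using that D by auto
      have "F y - F z = (1/2) *\<^sub>R ((y o\<^sub>L (y - z)) + ((y - z) o\<^sub>L z))"
        unfolding F_def by (rule blinfun_eqI)
          (simp add: blinfun.add_left blinfun.diff_left blinfun.diff_right blinfun.scaleR_left algebra_simps)
      moreover have "norm (y o\<^sub>L (y - z)) \<le> r * norm (y - z)" by (rule yy[OF n(1)])
      moreover have "norm ((y - z) o\<^sub>L z) \<le> r * norm (y - z)"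
        using norm_blinfun_compose[of "y - z" z] mult_left_mono[OF n(2) norm_ge_zero[of "y - z"]]
        by (simp add: mult.commute)
      ultimately show ?thesis
        using norm_triangle_ineq[of "y o\<^sub>L (y - z)" "(y - z) o\<^sub>L z"] by (simp add: dist_norm)
    qed
  qed
  then obtain y where y: "y \<in> D" "F y = y" by blast
  then have yA: "y \<in> A" "norm y \<le> r" using D by auto
  \<comment> \<open>The adjoint of the fixed point is again a fixed point in \<open>D\<close>, so
    uniqueness makes \<open>y\<close> self-adjoint.\<close>
  obtain z where z: "z \<in> A" "adj y z" using adj_ex[OF yA(1)] by auto
  have "adj (F y) (F z)"
    unfolding F_def by (intro adj_scaleR adj_add adj_compose b z)
  then have "F z = z" using y(2) z(2) adj_unique by simp
  moreover have "z \<in> D" using D z adj_norm_le[OF z(2)] yA(2) by simp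
  ultimately have "z = y" using ex y by blast
  moreover have "y o\<^sub>L y = 2 *\<^sub>R F y - b" by (simp add: F_def)
  ultimately show thesis using that[of y] yA z(2) r y(2) by simp
qed

text \<open>Here h = (S T + eps e)^(1/2), with S the adjoint of T, and w = T h^(-1). The
  perturbation makes \<open>h\<close> invertible relative to \<open>e\<close>, so that
  \<open>w\<close> stays in \<open>A\<close>.\<close>

lemma polar:
  assumes T: "T \<in> A" and eps: "eps > 0"
  obtains h w where "h \<in> A" "adj h h" "w \<in> A" "norm w \<le> 1" "\<And>x. w (h x) = T x"
    "\<And>x. (norm (h x))\<^sup>2 = (norm (T x))\<^sup>2 + eps * (norm (e x))\<^sup>2"
proof -
  obtain S where S: "S \<in> A" "adj T S" using adj_ex[OF T] by auto
  define M where "M = (norm T)\<^sup>2 + 1"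
  have M: "M > 0" by (simp add: M_def add_nonneg_pos)
  \<comment> \<open>Chosen so that (M + eps)(e - b) = S T + eps e while the norm of \<open>b\<close>
    stays below 1, as \<open>sqrt_ex\<close> requires.\<close>
  define b where "b = (M / (M + eps)) *\<^sub>R (e - (1 / M) *\<^sub>R (S o\<^sub>L T))"
  have bA: "b \<in> A" unfolding b_def by (intro scaleR_mem diff_mem compose_mem unit_mem S T)
  have bb: "adj b b"
    unfolding b_def using S by (intro adj_scaleR adj_diff adj_compose unit_adj adj_sym[OF S(2)])
  have "norm (e - (1 / M) *\<^sub>R (S o\<^sub>L T)) \<le> 1"
    by (rule norm_unit_minus_le[OF T S(2)]) (use M in \<open>auto simp: M_def field_simps\<close>)
  then have "norm b \<le> (M / (M + eps)) * 1"
    unfolding b_def norm_scaleR using M eps by (intro mult_mono) auto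
  moreover have "M / (M + eps) < 1" using M eps by simp
  ultimately have "norm b < 1" by simp
  then obtain y where y: "y \<in> A" "adj y y" "norm y < 1" "y o\<^sub>L y = 2 *\<^sub>R y - b"
    using sqrt_ex[OF bA bb] by metis
  define q where "q = e - y"
  have q: "q \<in> A" "adj q q" unfolding q_def using y by (auto intro: diff_mem unit_mem adj_diff unit_adj)
  have "norm (e - q) < 1" using y by (simp add: q_def)
  then obtain k where k: "k \<in> A" "\<And>x. q (k x) = e x" "\<And>x. k (q x) = e x"
    using inverse_ex[OF q(1)] by metis
  define t where "t = sqrt (M + eps)"
  have t: "t > 0" "t * t = M + eps" using M eps by (auto simp: t_def)
  define h where "h = t *\<^sub>R q"
  define w where "w = (1 / t) *\<^sub>R (T o\<^sub>L k)"
  have hA: "h \<in> A" "adj h h" unfolding h_def using q by (auto intro: scaleR_mem adj_scaleR)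
  have wA: "w \<in> A" unfolding w_def using T k by (auto intro: scaleR_mem compose_mem)
  have wh: "w (h x) = T x" for x
    using t by (simp add: w_def h_def blinfun.scaleR_left blinfun.scaleR_right k unit_right T)
  have qq: "q (q x) = e x - b x" for x
  proof -
    have "y (y x) = 2 *\<^sub>R y x - b x"
      using arg_cong[OF y(4), of "\<lambda>T. T x"] by (simp add: blinfun.diff_left blinfun.scaleR_left)
    then show ?thesis
      by (simp add: q_def blinfun.diff_left blinfun.diff_right unit_left unit_right unit_mem y scaleR_2)
  qed
  have hh: "h (h x) = S (T x) + eps *\<^sub>R e x" for x
  proof -
    have 1: "h (h x) = (M + eps) *\<^sub>R e x - (M + eps) *\<^sub>R b x"
      using t by (simp add: h_def blinfun.scaleR_left blinfun.scaleR_right qq scaleR_diff_right)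
    have 2: "(M + eps) *\<^sub>R b x = M *\<^sub>R e x - S (T x)"
      using M eps by (simp add: b_def blinfun.diff_left blinfun.scaleR_left scaleR_diff_right)
    show ?thesis unfolding 1 2 by (simp add: scaleR_add_left)
  qed
  have nh: "(norm (h x))\<^sup>2 = (norm (T x))\<^sup>2 + eps * (norm (e x))\<^sup>2" for x
  proof -
    have "(norm (h x))\<^sup>2 = ip x (h (h x))" using adjD[OF hA(2), of x "h x"] by (simp add: ip_self)
    also have "\<dots> = ip x (S (T x)) + eps * ip x (e (e x))" by (simp add: hh ip_simps unit_left unit_mem)
    also have "\<dots> = (norm (T x))\<^sup>2 + eps * (norm (e x))\<^sup>2"
      using adjD[OF S(2), of x "T x"] adjD[OF unit_adj, of x "e x"] by (simp add: ip_self)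
    finally show ?thesis .
  qed
  \<comment> \<open>With z the image of x under the inverse of h, |w x| = |T z| <= |h z| = |e
    x|.\<close>
  have "norm w \<le> 1"
  proof (rule norm_blinfun_bound)
    fix x
    define z where "z = (1 / t) *\<^sub>R k x"
    have "w x = T z" by (simp add: w_def z_def blinfun.scaleR_left blinfun.scaleR_right)
    moreover have "h z = e x" using t by (simp add: h_def z_def blinfun.scaleR_left blinfun.scaleR_right k)
    moreover have "(norm (T z))\<^sup>2 \<le> (norm (h z))\<^sup>2" using nh[of z] eps by simp
    ultimately have "norm (w x) \<le> norm (e x)" by (simp add: power2_le_iff_abs_le)
    then show "norm (w x) \<le> 1 * norm x" using norm_unit_le[of x] by simp
  qed simp
  then show thesis using that[OF hA wA _ wh nh] by simp
qed

section \<open>Approximation of columns\<close>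

text \<open>One round of truncation turns a squared error delta into 2 g^2 + delta/2, whose fixed
  point is 4 g^2; \<open>r\<close> counts the rounds. The remainder is a column indexed by the
  \<open>2 ^ n\<close> sign vectors, so the induction generalises over \<open>n\<close> and
  \<open>h\<close>.\<close>

lemma selfadjoint_column_approx:
  fixes h :: "nat \<Rightarrow> 'h \<Rightarrow>\<^sub>L 'h"
  assumes B0: "0 \<in> B" and Badd: "\<And>S T. S \<in> B \<Longrightarrow> T \<in> B \<Longrightarrow> S + T \<in> B"
    and Bscale: "\<And>r T. T \<in> B \<Longrightarrow> r *\<^sub>R T \<in> B"
    and near: "\<And>a. a \<in> A \<Longrightarrow> norm a \<le> 1 \<Longrightarrow> \<exists>b\<in>B. norm (a - b) \<le> g"
    and hA: "\<And>i. i < n \<Longrightarrow> h i \<in> A" and hh: "\<And>i. i < n \<Longrightarrow> adj (h i) (h i)"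
    and hb: "\<And>x. (\<Sum>i<n. (norm (h i x))\<^sup>2) \<le> (norm x)\<^sup>2"
  shows "\<exists>c. (\<forall>i<n. c i \<in> B) \<and>
    (\<forall>x. (\<Sum>i<n. (norm (h i x - c i x))\<^sup>2) \<le> (4 * g\<^sup>2 + (1/2) ^ r) * (norm x)\<^sup>2)"
  using hA hh hb
proof (induction r arbitrary: n h)
  case 0
  have "(norm x)\<^sup>2 \<le> (4 * g\<^sup>2 + 1) * (norm x)\<^sup>2" for x :: 'h
    by (simp add: algebra_simps)
  then show ?case
    using B0 order_trans[OF "0.prems"(3)] by (intro exI[of _ "\<lambda>_. 0"]) simp
next
  case (Suc r)
  define s where "s = rsum n h"
  define N :: real where "N = 2 ^ n"
  have N: "N > 0" by (simp add: N_def)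
  have sA: "s k \<in> A" for k
    unfolding s_def rsum_def using Suc.prems(1) by (auto intro: sum_mem scaleR_mem)
  have ss: "adj (s k) (s k)" for k
    unfolding s_def rsum_def using Suc.prems(2) by (auto intro: adj_sum adj_scaleR)
  \<comment> \<open>The constant is 1 + 2. For y = sum of h_i^2 x, the column bound at x and at y
    gives 2 |y|^2 <= |x|^2 + |y|^2, so |y| <= |x|; using the column bound twice bounds the double
    sum by |x|^2.\<close>
  have fourth: "(\<Sum>k<2 ^ n. (norm (s k (s k x)))\<^sup>2) \<le> N * (3 * (norm x)\<^sup>2)" for x
  proof -
    define y where "y = (\<Sum>i<n. h i (h i x))"
    have "2 * (norm y)\<^sup>2 = (\<Sum>i<n. 2 * ip (h i (h i x)) y)"
      unfolding ip_self[symmetric] by (subst (1) y_def) (simp add: ip_sum_left sum_distrib_left)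
    also have "\<dots> = (\<Sum>i<n. 2 * ip (h i x) (h i y))"
      using Suc.prems(2) by (intro sum.cong) (auto simp: adjD)
    also have "\<dots> \<le> (\<Sum>i<n. (norm (h i x))\<^sup>2 + (norm (h i y))\<^sup>2)" by (intro sum_mono ip_le_sq)
    also have "\<dots> \<le> (norm x)\<^sup>2 + (norm y)\<^sup>2"
      using Suc.prems(3)[of x] Suc.prems(3)[of y] by (simp add: sum.distrib)
    finally have 1: "(norm y)\<^sup>2 \<le> (norm x)\<^sup>2" by simp
    have "(\<Sum>i<n. \<Sum>j<n. (norm (h i (h j x)))\<^sup>2) = (\<Sum>j<n. \<Sum>i<n. (norm (h i (h j x)))\<^sup>2)"
      by (rule sum.swap)
    also have "\<dots> \<le> (\<Sum>j<n. (norm (h j x))\<^sup>2)" by (intro sum_mono Suc.prems(3))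
    also have "\<dots> \<le> (norm x)\<^sup>2" by (rule Suc.prems(3))
    finally have 2: "(\<Sum>i<n. \<Sum>j<n. (norm (h i (h j x)))\<^sup>2) \<le> (norm x)\<^sup>2" .
    show ?thesis
      unfolding s_def N_def
    proof (rule order_trans[OF rsum_fourth_moment mult_left_mono])
      show "(norm (\<Sum>i<n. h i (h i x)))\<^sup>2 + 2 * (\<Sum>i<n. \<Sum>j<n. (norm (h i (h j x)))\<^sup>2) \<le> 3 * (norm x)\<^sup>2"
        using 1 2 unfolding y_def by linarith
    qed simp
  qed
  have "\<exists>f. f \<in> A \<and> adj f f \<and> norm f \<le> 1 \<and> (\<forall>x. norm (s k x - f x) \<le> norm (s k (s k x)) / 4)" for k
    using truncation[OF sA[of k] ss[of k]] by metis
  then obtain f where f: "\<And>k. f k \<in> A" "\<And>k. adj (f k) (f k)" "\<And>k. norm (f k) \<le> 1"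
      "\<And>k x. norm (s k x - f k x) \<le> norm (s k (s k x)) / 4"
    by metis
  obtain b where b: "\<And>k. b k \<in> B" "\<And>k. norm (f k - b k) \<le> g"
    using near[OF f(1) f(3)] by metis
  \<comment> \<open>The squares |(s - f) x|^2 sum to at most 3 N / 16 times |x|^2, so division by
    m^2 = N/4 leaves 3/4 <= 1 and \<open>h'\<close> is an admissible column. Later 2 m^2 = N/2
    produces the halving of the error.\<close>
  define m where "m = sqrt N / 2"
  have m: "m > 0" "m\<^sup>2 = N / 4" using N by (simp_all add: m_def power_divide)
  define h' where "h' = (\<lambda>k. (1 / m) *\<^sub>R (s k - f k))"
  have h': "s k x - f k x = m *\<^sub>R h' k x" for k x
    using m by (simp add: h'_def blinfun.scaleR_left blinfun.diff_left)
  have h'A: "h' k \<in> A" for k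
    unfolding h'_def by (intro scaleR_mem diff_mem sA f)
  have h'h': "adj (h' k) (h' k)" for k
    unfolding h'_def by (intro adj_scaleR adj_diff ss f)
  have "(\<Sum>k<2 ^ n. (norm (h' k x))\<^sup>2) \<le> (norm x)\<^sup>2" for x
  proof -
    have "N * (norm (h' k x))\<^sup>2 \<le> (norm (s k (s k x)))\<^sup>2 / 4" for k
    proof -
      have "m\<^sup>2 * (norm (h' k x))\<^sup>2 = (norm (s k x - f k x))\<^sup>2"
        by (simp add: h' power_mult_distrib)
      also have "\<dots> \<le> (norm (s k (s k x)) / 4)\<^sup>2" by (intro power_mono f(4)) simp
      finally show ?thesis by (simp add: m power_divide)
    qed
    then have "N * (\<Sum>k<2 ^ n. (norm (h' k x))\<^sup>2) \<le> (\<Sum>k<2 ^ n. (norm (s k (s k x)))\<^sup>2 / 4)"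
      unfolding sum_distrib_left by (rule sum_mono)
    also have "\<dots> = (\<Sum>k<2 ^ n. (norm (s k (s k x)))\<^sup>2) / 4"
      by (simp only: sum_divide_distrib)
    also have "\<dots> \<le> N * (3 * (norm x)\<^sup>2) / 4" using fourth[of x] by simp
    also have "\<dots> = N * (3 / 4 * (norm x)\<^sup>2)" by simp
    finally have "(\<Sum>k<2 ^ n. (norm (h' k x))\<^sup>2) \<le> 3 / 4 * (norm x)\<^sup>2"
      using N by (simp only: mult_le_cancel_left_pos)
    then show ?thesis using zero_le_power2[of "norm x"] by linarith
  qed
  then obtain c' where c': "\<And>k. k < 2 ^ n \<Longrightarrow> c' k \<in> B"
      "\<And>x. (\<Sum>k<2 ^ n. (norm (h' k x - c' k x))\<^sup>2) \<le> (4 * g\<^sup>2 + (1/2) ^ r) * (norm x)\<^sup>2"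
    using Suc.IH[of "2 ^ n" h', OF h'A h'h'] by blast
  \<comment> \<open>\<open>d k\<close> approximates \<open>s k\<close>: \<open>b k\<close> stands
    for the truncated part and \<open>m *\<^sub>R c' k\<close> for the remainder. Averaging against
    the signs then gives the entries \<open>c i\<close>, and Bessel's inequality transfers the
    error.\<close>
  define d where "d = (\<lambda>k. b k + m *\<^sub>R c' k)"
  define c where "c = (\<lambda>i. (1 / N) *\<^sub>R (\<Sum>k<2 ^ n. rsign i k *\<^sub>R d k))"
  have Bsum: "(\<Sum>k\<in>I. T k) \<in> B" if "\<And>k. k \<in> I \<Longrightarrow> T k \<in> B" for I :: "nat set" and T
    using that by (induction I rule: infinite_finite_induct) (auto simp: B0 Badd)
  have cB: "c i \<in> B" for i
    unfolding c_def d_def using b(1) c'(1) by (auto intro!: Bscale Bsum Badd)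
  have "(\<Sum>i<n. (norm (h i x - c i x))\<^sup>2) \<le> (4 * g\<^sup>2 + (1/2) ^ Suc r) * (norm x)\<^sup>2" for x
  proof -
    define z where "z = (\<lambda>k. s k x - d k x)"
    have hc: "N *\<^sub>R (h i x - c i x) = (\<Sum>k<2 ^ n. rsign i k *\<^sub>R z k)" if "i < n" for i
    proof -
      have "N *\<^sub>R h i x = (\<Sum>k<2 ^ n. rsign i k *\<^sub>R s k x)"
        using rsum_reconstruct[OF that, of "\<lambda>i. h i x"] by (simp add: s_def rsum_blinfun N_def)
      moreover have "N *\<^sub>R c i x = (\<Sum>k<2 ^ n. rsign i k *\<^sub>R d k x)"
        using N by (simp add: c_def blinfun.scaleR_left blinfun.sum_left)
      ultimately show ?thesis by (simp add: z_def scaleR_diff_right sum_subtractf)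
    qed
    have "N\<^sup>2 * (\<Sum>i<n. (norm (h i x - c i x))\<^sup>2) = (\<Sum>i<n. (norm (N *\<^sub>R (h i x - c i x)))\<^sup>2)"
      by (simp add: sum_distrib_left power_mult_distrib)
    also have "\<dots> = (\<Sum>i<n. (norm (\<Sum>k<2 ^ n. rsign i k *\<^sub>R z k))\<^sup>2)"
      by (intro sum.cong) (simp_all add: hc)
    also have "\<dots> \<le> N * (\<Sum>k<2 ^ n. (norm (z k))\<^sup>2)"
      unfolding N_def by (rule rsign_bessel)
    finally have 1: "N * (\<Sum>i<n. (norm (h i x - c i x))\<^sup>2) \<le> (\<Sum>k<2 ^ n. (norm (z k))\<^sup>2)"
      using N by (simp add: power2_eq_square)
    have "(norm (z k))\<^sup>2 \<le> 2 * g\<^sup>2 * (norm x)\<^sup>2 + N / 2 * (norm (h' k x - c' k x))\<^sup>2" for k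
    proof -
      have "z k = (f k x - b k x) + m *\<^sub>R (h' k x - c' k x)"
        unfolding scaleR_diff_right h'[symmetric]
        by (simp add: z_def d_def blinfun.add_left blinfun.scaleR_left)
      then have "(norm (z k))\<^sup>2 \<le> 2 * (norm (f k x - b k x))\<^sup>2 + 2 * (m\<^sup>2 * (norm (h' k x - c' k x))\<^sup>2)"
        using norm_add_sq_le[of "f k x - b k x" "m *\<^sub>R (h' k x - c' k x)"]
        by (simp add: power_mult_distrib)
      moreover have "norm (f k x - b k x) \<le> g * norm x"
        using norm_blinfun[of "f k - b k" x] mult_right_mono[OF b(2)[of k] norm_ge_zero[of x]]
        by (simp add: blinfun.diff_left)
      then have "(norm (f k x - b k x))\<^sup>2 \<le> g\<^sup>2 * (norm x)\<^sup>2"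
        by (metis norm_ge_zero power_mono power_mult_distrib)
      ultimately show ?thesis by (simp add: m)
    qed
    then have "(\<Sum>k<2 ^ n. (norm (z k))\<^sup>2)
        \<le> (\<Sum>k<2 ^ n. 2 * g\<^sup>2 * (norm x)\<^sup>2 + N / 2 * (norm (h' k x - c' k x))\<^sup>2)"
      by (intro sum_mono)
    also have "\<dots> = N * (2 * g\<^sup>2 * (norm x)\<^sup>2) + N / 2 * (\<Sum>k<2 ^ n. (norm (h' k x - c' k x))\<^sup>2)"
      by (simp add: sum.distrib sum_distrib_left N_def)
    also have "\<dots> \<le> N * (2 * g\<^sup>2 * (norm x)\<^sup>2) + N / 2 * ((4 * g\<^sup>2 + (1/2) ^ r) * (norm x)\<^sup>2)"
      using N c'(2)[of x] by simp
    also have "\<dots> = N * ((4 * g\<^sup>2 + (1/2) ^ Suc r) * (norm x)\<^sup>2)"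
      by (simp add: algebra_simps)
    finally show ?thesis using 1 N by (smt (verit) mult_le_cancel_left_pos)
  qed
  then show ?case using cB by blast
qed

end

section \<open>From columns to rows\<close>

lemma adj_if_is_adjoint: "is_adjoint T S \<Longrightarrow> adj T S"
  by (simp add: adj_def is_adjoint_def ip_def)

lemma scaleR_eq_scale_op: "r *\<^sub>R T = scale_op (complex_of_real r) T"
  by (rule blinfun_eqI) (simp add: scale_op_apply blinfun.scaleR_left scaleR_scaleC)

lemma unital_cstar_subalgebra_operator_algebra:
  assumes "unital_cstar_subalgebra A"
  obtains e where "operator_algebra A e"
proof -
  obtain e where e: "e \<in> A" "\<forall>T\<in>A. e o\<^sub>L T = T \<and> T o\<^sub>L e = T" and A: "cstar_subalgebra A"
    using assms unfolding unital_cstar_subalgebra_def by blast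
  show thesis
  proof (rule that[of e], unfold_locales)
    show "\<exists>S\<in>A. adj T S" if "T \<in> A" for T
      using A that adj_if_is_adjoint unfolding cstar_subalgebra_def by blast
  qed (use A e in \<open>auto simp: cstar_subalgebra_def scaleR_eq_scale_op\<close>)
qed

text \<open>A row and the column of the adjoints of its entries are adjoint to each other, so they
  have the same norm. Forwards, the row is tested on v_j = S_j x and a factor C is cancelled;
  backwards, the Cauchy-Schwarz inequality is applied to the pairing and a factor |y|^2 is
  cancelled.\<close>

lemma row_bound_iff_column_bound:
  fixes T S :: "nat \<Rightarrow> 'h::complex_hilbert_space \<Rightarrow>\<^sub>L 'h"
  assumes adj: "\<And>j. j < n \<Longrightarrow> adj (T j) (S j)" and c: "0 \<le> c"
  shows "(\<forall>v. (norm (\<Sum>j<n. T j (v j)))\<^sup>2 \<le> c * (\<Sum>j<n. (norm (v j))\<^sup>2))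
    \<longleftrightarrow> (\<forall>x. (\<Sum>j<n. (norm (S j x))\<^sup>2) \<le> c * (norm x)\<^sup>2)" (is "?row \<longleftrightarrow> ?col")
proof
  have pair: "ip (\<Sum>j<n. T j (v j)) x = (\<Sum>j<n. ip (v j) (S j x))" for v x
    unfolding ip_sum_left using adj by (intro sum.cong) (auto simp: adjD)
  {
    assume row: ?row
    show ?col
    proof
      fix x
      define y where "y = (\<Sum>j<n. T j (S j x))"
      define C where "C = (\<Sum>j<n. (norm (S j x))\<^sup>2)"
      have C0: "0 \<le> C" unfolding C_def by (intro sum_nonneg) auto
      have "C = ip y x" unfolding y_def pair by (simp add: C_def ip_self)
      also have "\<dots> \<le> norm y * norm x" by (rule ip_le_norm)
      finally have "C\<^sup>2 \<le> (norm y)\<^sup>2 * (norm x)\<^sup>2"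
        using C0 by (metis power_mono power_mult_distrib)
      also have "\<dots> \<le> c * C * (norm x)\<^sup>2"
        using row[rule_format, of "\<lambda>j. S j x"] unfolding y_def C_def by (intro mult_right_mono) auto
      finally have "C * C \<le> C * (c * (norm x)\<^sup>2)" by (simp add: power2_eq_square mult_ac)
      then have "C \<le> c * (norm x)\<^sup>2"
        using C0 c by (cases "C = 0") (auto simp: mult_le_cancel_left)
      then show "(\<Sum>j<n. (norm (S j x))\<^sup>2) \<le> c * (norm x)\<^sup>2" by (simp add: C_def)
    qed
  next
    assume col: ?col
    show ?row
    proof
      fix v
      define y where "y = (\<Sum>j<n. T j (v j))"
      define V where "V = (\<Sum>j<n. (norm (v j))\<^sup>2)"
      have V0: "0 \<le> V" unfolding V_def by (intro sum_nonneg) auto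
      have "(norm y)\<^sup>2 = (\<Sum>j<n. ip (v j) (S j y))" unfolding ip_self[symmetric] by (subst (1) y_def) (rule pair)
      also have "\<dots> \<le> (\<Sum>j<n. norm (v j) * norm (S j y))" by (intro sum_mono ip_le_norm)
      finally have "((norm y)\<^sup>2)\<^sup>2 \<le> (\<Sum>j<n. norm (v j) * norm (S j y))\<^sup>2"
        by (intro power_mono) auto
      also have "\<dots> \<le> V * (\<Sum>j<n. (norm (S j y))\<^sup>2)"
        unfolding V_def by (rule Cauchy_Schwarz_ineq_sum)
      also have "\<dots> \<le> V * (c * (norm y)\<^sup>2)" using col V0 by (intro mult_left_mono) auto
      finally have "(norm y)\<^sup>2 * (norm y)\<^sup>2 \<le> (norm y)\<^sup>2 * (c * V)"
        by (simp only: power2_eq_square mult_ac)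
      then have "(norm y)\<^sup>2 \<le> c * V"
        using V0 c
        by (metis mult_le_cancel_left_pos mult_nonneg_nonneg norm_zero zero_eq_power2 zero_less_power2)
      then show "(norm (\<Sum>j<n. T j (v j)))\<^sup>2 \<le> c * (\<Sum>j<n. (norm (v j))\<^sup>2)"
        by (simp add: V_def y_def)
    qed
  }
qed

text \<open>In x_i = w_i h_i the contractions w_i are approximated one at a time, without regard to
  n, and only the self-adjoint column needs the averaging argument.\<close>

lemma column_approx:
  fixes x :: "nat \<Rightarrow> 'h::complex_hilbert_space \<Rightarrow>\<^sub>L 'h"
  assumes A: "operator_algebra A e" and B: "operator_algebra B e'"
    and near: "\<And>a. a \<in> A \<Longrightarrow> norm a \<le> 1 \<Longrightarrow> \<exists>b\<in>B. norm b \<le> 1 \<and> norm (a - b) \<le> g"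
    and g: "g > 0"
    and x: "\<And>i. i < n \<Longrightarrow> x i \<in> A"
    and xb: "\<And>v. (\<Sum>i<n. (norm (x i v))\<^sup>2) \<le> (norm v)\<^sup>2"
  obtains y where "\<And>i. i < n \<Longrightarrow> y i \<in> B"
    "\<And>v. (\<Sum>i<n. (norm (x i v - y i v))\<^sup>2) \<le> (7 * g)\<^sup>2 * (norm v)\<^sup>2"
proof -
  interpret A: operator_algebra A e by (rule A)
  interpret B: operator_algebra B e' by (rule B)
  \<comment> \<open>The n perturbations add at most 3 to the squared column norm, which becomes at
    most 4; this is why \<open>k\<close> is half of \<open>h\<close>.\<close>
  define \<epsilon> where "\<epsilon> = 3 / (real n + 1)"
  have eps: "\<epsilon> > 0" "real n * \<epsilon> \<le> 3" by (auto simp: \<epsilon>_def field_simps)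
  define P where "P = (\<lambda>i h w. h \<in> A \<and> adj h h \<and> w \<in> A \<and> norm w \<le> 1 \<and>
    (\<forall>v. w (h v) = x i v) \<and> (\<forall>v. (norm (h v))\<^sup>2 = (norm (x i v))\<^sup>2 + \<epsilon> * (norm (e v))\<^sup>2))"
  have "\<exists>h w. P i h w" if "i < n" for i
    by (rule A.polar[OF x[OF that] eps(1)]) (auto simp: P_def)
  then obtain h w where "\<And>i. i < n \<Longrightarrow> P i (h i) (w i)" by metis
  then have hw: "\<And>i. i < n \<Longrightarrow> h i \<in> A" "\<And>i. i < n \<Longrightarrow> adj (h i) (h i)"
      "\<And>i. i < n \<Longrightarrow> w i \<in> A" "\<And>i. i < n \<Longrightarrow> norm (w i) \<le> 1" "\<And>i v. i < n \<Longrightarrow> w i (h i v) = x i v"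
      "\<And>i v. i < n \<Longrightarrow> (norm (h i v))\<^sup>2 = (norm (x i v))\<^sup>2 + \<epsilon> * (norm (e v))\<^sup>2"
    by (auto simp: P_def)
  define k where "k = (\<lambda>i. (1/2) *\<^sub>R h i)"
  have kb: "(\<Sum>i<n. (norm (k i v))\<^sup>2) \<le> (norm v)\<^sup>2" for v
  proof -
    have "(\<Sum>i<n. (norm (h i v))\<^sup>2) = (\<Sum>i<n. (norm (x i v))\<^sup>2) + real n * \<epsilon> * (norm (e v))\<^sup>2"
      by (simp add: hw(6) sum.distrib)
    also have "\<dots> \<le> (norm v)\<^sup>2 + 3 * (norm v)\<^sup>2"
      using eps A.norm_unit_le[of v] by (intro add_mono xb mult_mono power_mono) auto
    finally show ?thesis
      by (simp add: k_def blinfun.scaleR_left power_divide sum_divide_distrib[symmetric])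
  qed
  \<comment> \<open>Enough rounds to lower the error 4 g^2 + 2^(-r) to 5 g^2.\<close>
  obtain r where r: "(1/2 :: real) ^ r < g\<^sup>2" using real_arch_pow_inv[of "g\<^sup>2" "1/2"] g by auto
  obtain c where c: "\<And>i. i < n \<Longrightarrow> c i \<in> B"
      "\<And>v. (\<Sum>i<n. (norm (k i v - c i v))\<^sup>2) \<le> (4 * g\<^sup>2 + (1/2) ^ r) * (norm v)\<^sup>2"
  proof -
    have "\<exists>c. (\<forall>i<n. c i \<in> B) \<and>
      (\<forall>x. (\<Sum>i<n. (norm (k i x - c i x))\<^sup>2) \<le> (4 * g\<^sup>2 + (1/2) ^ r) * (norm x)\<^sup>2)"
    proof (rule A.selfadjoint_column_approx)
      show "\<exists>b\<in>B. norm (a - b) \<le> g" if "a \<in> A" "norm a \<le> 1" for a using near[OF that] by blast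
    qed (use hw kb in \<open>auto simp: k_def A.scaleR_mem adj_scaleR B.zero_mem B.add_mem B.scaleR_mem\<close>)
    then show thesis using that by blast
  qed
  have "\<exists>b\<in>B. norm b \<le> 1 \<and> norm (w i - b) \<le> g" if "i < n" for i using near hw that by blast
  then obtain b where b: "\<And>i. i < n \<Longrightarrow> b i \<in> B" "\<And>i. i < n \<Longrightarrow> norm (b i) \<le> 1"
      "\<And>i. i < n \<Longrightarrow> norm (w i - b i) \<le> g"
    by metis
  define y where "y = (\<lambda>i. 2 *\<^sub>R (b i o\<^sub>L c i))"
  have "(\<Sum>i<n. (norm (x i v - y i v))\<^sup>2) \<le> (7 * g)\<^sup>2 * (norm v)\<^sup>2" for v
  proof -
    have step: "(norm (x i v - y i v))\<^sup>2 \<le> 8 * (norm (k i v - c i v))\<^sup>2 + 8 * (g\<^sup>2 * (norm (k i v))\<^sup>2)"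
      if i: "i < n" for i
    proof -
      have "x i v = 2 *\<^sub>R w i (k i v)"
        using hw(5)[OF i, of v] by (simp add: k_def blinfun.scaleR_left blinfun.scaleR_right)
      \<comment> \<open>In the first summand \<open>b i\<close> is a contraction acting on the
        column error; in the second the small factor w - b acts on the bounded column
        \<open>k\<close>.\<close>
      then have eq: "x i v - y i v = 2 *\<^sub>R (b i (k i v - c i v) + (w i - b i) (k i v))"
        by (simp add: y_def blinfun.scaleR_left blinfun.diff_left blinfun.diff_right scaleR_diff_right)
      have 1: "norm (b i (k i v - c i v)) \<le> norm (k i v - c i v)"
        using norm_blinfun[of "b i" "k i v - c i v"] mult_right_mono[OF b(2)[OF i] norm_ge_zero[of "k i v - c i v"]]
        by simp
      have "norm ((w i - b i) (k i v)) \<le> g * norm (k i v)"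
        using norm_blinfun[of "w i - b i" "k i v"] mult_right_mono[OF b(3)[OF i] norm_ge_zero[of "k i v"]]
        by simp
      then have 2: "(norm ((w i - b i) (k i v)))\<^sup>2 \<le> g\<^sup>2 * (norm (k i v))\<^sup>2"
        by (metis norm_ge_zero power_mono power_mult_distrib)
      have "(norm (x i v - y i v))\<^sup>2 = 4 * (norm (b i (k i v - c i v) + (w i - b i) (k i v)))\<^sup>2"
        unfolding eq by (simp add: power_mult_distrib)
      also have "\<dots> \<le> 4 * (2 * (norm (b i (k i v - c i v)))\<^sup>2 + 2 * (norm ((w i - b i) (k i v)))\<^sup>2)"
        by (intro mult_left_mono norm_add_sq_le) simp
      also have "\<dots> \<le> 4 * (2 * (norm (k i v - c i v))\<^sup>2 + 2 * (g\<^sup>2 * (norm (k i v))\<^sup>2))"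
        using power_mono[OF 1 norm_ge_zero, of 2] 2 by (intro mult_left_mono add_mono) auto
      finally show ?thesis by simp
    qed
    have "(\<Sum>i<n. (norm (x i v - y i v))\<^sup>2)
        \<le> (\<Sum>i<n. 8 * (norm (k i v - c i v))\<^sup>2 + 8 * (g\<^sup>2 * (norm (k i v))\<^sup>2))"
      by (intro sum_mono step) simp
    also have "\<dots> = 8 * (\<Sum>i<n. (norm (k i v - c i v))\<^sup>2) + 8 * (g\<^sup>2 * (\<Sum>i<n. (norm (k i v))\<^sup>2))"
      by (simp add: sum.distrib sum_distrib_left)
    also have "\<dots> \<le> 8 * ((5 * g\<^sup>2) * (norm v)\<^sup>2) + 8 * (g\<^sup>2 * (norm v)\<^sup>2)"
    proof (intro add_mono mult_left_mono kb)
      show "(\<Sum>i<n. (norm (k i v - c i v))\<^sup>2) \<le> 5 * g\<^sup>2 * (norm v)\<^sup>2"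
        by (rule order_trans[OF c(2) mult_right_mono]) (use r in auto)
    qed auto
    \<comment> \<open>8 * 5 + 8 = 48 <= 7^2.\<close>
    also have "\<dots> \<le> (7 * g)\<^sup>2 * (norm v)\<^sup>2"
      by (simp add: power_mult_distrib)
    finally show ?thesis .
  qed
  moreover have "y i \<in> B" if "i < n" for i
    unfolding y_def using b c that by (intro B.scaleR_mem B.compose_mem)
  ultimately show thesis using that by blast
qed

section \<open>Norms of one-row operator matrices\<close>

lemma mat_norm_row:
  assumes n: "n \<ge> 1" and T: "\<forall>i>0. \<forall>j. T i j = 0"
  shows "mat_norm n T = (SUP h\<in>{h. (\<Sum>j<n. (norm (h j))\<^sup>2) \<le> 1}. norm (\<Sum>j<n. T 0 j (h j)))"
proof -
  have "(\<Sum>i<n. (norm (\<Sum>j<n. T i j (h j)))\<^sup>2) = (norm (\<Sum>j<n. T 0 j (h j)))\<^sup>2" for h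
    using n T by (subst sum.remove[of _ 0]) auto
  then show ?thesis by (simp add: mat_norm_def)
qed

text \<open>The real supremum in \<open>mat_norm\<close> is meaningful only for a bounded set; the
  sum of the entry norms is a crude bound.\<close>

lemma row_bounded:
  fixes T :: "nat \<Rightarrow> 'h::complex_hilbert_space \<Rightarrow>\<^sub>L 'h"
  shows "bdd_above ((\<lambda>h. norm (\<Sum>j<n. T j (h j))) ` {h. (\<Sum>j<n. (norm (h j))\<^sup>2) \<le> 1})"
proof (rule bdd_aboveI2)
  fix h :: "nat \<Rightarrow> 'h" assume "h \<in> {h. (\<Sum>j<n. (norm (h j))\<^sup>2) \<le> 1}"
  then have h: "(\<Sum>j<n. (norm (h j))\<^sup>2) \<le> 1" by simp
  have "norm (h j) \<le> 1" if "j < n" for j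
  proof -
    have "(norm (h j))\<^sup>2 \<le> (\<Sum>j<n. (norm (h j))\<^sup>2)" using that by (intro member_le_sum) auto
    then have "(norm (h j))\<^sup>2 \<le> 1\<^sup>2" using h by simp
    then show ?thesis by (rule power2_le_imp_le) simp
  qed
  then have "norm (T j (h j)) \<le> norm (T j)" if "j < n" for j
    using norm_blinfun[of "T j" "h j"] mult_left_mono[of "norm (h j)" 1 "norm (T j)"] that by fastforce
  then show "norm (\<Sum>j<n. T j (h j)) \<le> (\<Sum>j<n. norm (T j))"
    by (intro sum_norm_le) auto
qed

text \<open>Homogeneity replaces the supremum over the unit ball by the quadratic inequality used in
  \<open>row_bound_iff_column_bound\<close>.\<close>

lemma mat_norm_row_le_iff:
  fixes T :: "nat \<Rightarrow> nat \<Rightarrow> 'h::complex_hilbert_space \<Rightarrow>\<^sub>L 'h"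
  assumes n: "n \<ge> 1" and T: "\<And>i j. i \<noteq> 0 \<Longrightarrow> T i j = 0" and c: "0 \<le> c"
  shows "mat_norm n T \<le> c \<longleftrightarrow>
    (\<forall>v :: nat \<Rightarrow> 'h. (norm (\<Sum>j<n. T 0 j (v j)))\<^sup>2 \<le> c\<^sup>2 * (\<Sum>j<n. (norm (v j))\<^sup>2))"
    (is "_ \<longleftrightarrow> ?row")
proof -
  have eq: "mat_norm n T = (SUP h\<in>{h. (\<Sum>j<n. (norm (h j))\<^sup>2) \<le> 1}. norm (\<Sum>j<n. T 0 j (h j)))"
    by (rule mat_norm_row[OF n]) (simp add: T)
  show ?thesis
  proof
    assume le: "mat_norm n T \<le> c"
    show ?row
    proof
      fix v :: "nat \<Rightarrow> 'h"
      define V where "V = sqrt (\<Sum>j<n. (norm (v j))\<^sup>2)"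
      have V2: "V\<^sup>2 = (\<Sum>j<n. (norm (v j))\<^sup>2)" unfolding V_def by (simp add: sum_nonneg)
      have V0: "V \<ge> 0" unfolding V_def by (simp add: sum_nonneg)
      show "(norm (\<Sum>j<n. T 0 j (v j)))\<^sup>2 \<le> c\<^sup>2 * (\<Sum>j<n. (norm (v j))\<^sup>2)"
      proof (cases "V = 0")
        case True
        then have "v j = 0" if "j < n" for j using V2 that by (simp add: sum_nonneg_eq_0_iff)
        then show ?thesis by (simp add: sum_nonneg)
      next
        case False
        define u where "u = (\<lambda>j. (1 / V) *\<^sub>R v j)"
        have "(\<Sum>j<n. (norm (u j))\<^sup>2) = (1 / V)\<^sup>2 * V\<^sup>2"
          unfolding V2 sum_distrib_left by (simp add: u_def power_divide)
        then have "u \<in> {h. (\<Sum>j<n. (norm (h j))\<^sup>2) \<le> 1}" using False by (simp add: power_divide)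
        then have "norm (\<Sum>j<n. T 0 j (u j)) \<le> mat_norm n T"
          unfolding eq by (rule cSUP_upper[OF _ row_bounded[of "T 0" n]])
        then have "norm (\<Sum>j<n. T 0 j (u j)) \<le> c" using le by simp
        moreover have "(\<Sum>j<n. T 0 j (v j)) = V *\<^sub>R (\<Sum>j<n. T 0 j (u j))"
          using False by (simp add: u_def blinfun.scaleR_right scaleR_sum_right)
        ultimately have "norm (\<Sum>j<n. T 0 j (v j)) \<le> c * V"
          using V0 by (simp add: mult.commute mult_left_mono)
        then show ?thesis unfolding V2[symmetric] power_mult_distrib[symmetric] by (intro power_mono) auto
      qed
    qed
  next
    assume row: ?row
    show "mat_norm n T \<le> c"
      unfolding eq
    proof (rule cSUP_least)
      show "{h :: nat \<Rightarrow> 'h. (\<Sum>j<n. (norm (h j))\<^sup>2) \<le> 1} \<noteq> {}"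
        by (auto intro!: exI[of _ "\<lambda>_. 0"])
      fix h :: "nat \<Rightarrow> 'h" assume "h \<in> {h. (\<Sum>j<n. (norm (h j))\<^sup>2) \<le> 1}"
      then have "c\<^sup>2 * (\<Sum>j<n. (norm (h j))\<^sup>2) \<le> c\<^sup>2 * 1" by (intro mult_left_mono) auto
      then have "(norm (\<Sum>j<n. T 0 j (h j)))\<^sup>2 \<le> c\<^sup>2" using row[rule_format, of h] by simp
      then show "norm (\<Sum>j<n. T 0 j (h j)) \<le> c" using c by (rule power2_le_imp_le)
    qed
  qed
qed

lemma mat_norm_nonneg:
  fixes T :: "nat \<Rightarrow> nat \<Rightarrow> 'h::complex_hilbert_space \<Rightarrow>\<^sub>L 'h"
  assumes n: "n \<ge> 1" and T: "\<And>i j. i \<noteq> 0 \<Longrightarrow> T i j = 0"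
  shows "0 \<le> mat_norm n T"
proof -
  have eq: "mat_norm n T = (SUP h\<in>{h. (\<Sum>j<n. (norm (h j))\<^sup>2) \<le> 1}. norm (\<Sum>j<n. T 0 j (h j)))"
    by (rule mat_norm_row[OF n]) (simp add: T)
  show ?thesis
    unfolding eq by (rule cSUP_upper2[OF row_bounded[of "T 0" n], of "\<lambda>_. 0"]) auto
qed

lemma mat_norm_uminus: "mat_norm n (- T) = mat_norm n T"
  by (simp add: mat_norm_def blinfun.minus_left sum_negf)

lemma mat_norm_zero_le: "n \<ge> 1 \<Longrightarrow> mat_norm n 0 \<le> 1"
  by (subst mat_norm_row_le_iff) (auto simp: sum_nonneg)

lemma mat_norm_one_le_iff:
  fixes T :: "nat \<Rightarrow> nat \<Rightarrow> 'h::complex_hilbert_space \<Rightarrow>\<^sub>L 'h"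
  assumes "\<And>i j. i \<noteq> 0 \<Longrightarrow> T i j = 0" and c: "0 \<le> c"
  shows "mat_norm 1 T \<le> c \<longleftrightarrow> norm (T 0 0) \<le> c"
proof -
  have "mat_norm 1 T \<le> c \<longleftrightarrow> (\<forall>v :: nat \<Rightarrow> 'h. norm (T 0 0 (v 0)) \<le> c * norm (v 0))"
    using assms by (subst mat_norm_row_le_iff)
      (auto simp: power_mult_distrib[symmetric] power2_le_iff_abs_le)
  also have "\<dots> \<longleftrightarrow> (\<forall>x. norm (T 0 0 x) \<le> c * norm x)"
  proof
    assume *: "\<forall>v :: nat \<Rightarrow> 'h. norm (T 0 0 (v 0)) \<le> c * norm (v 0)"
    show "\<forall>x. norm (T 0 0 x) \<le> c * norm x"
    proof
      show "norm (T 0 0 x) \<le> c * norm x" for x using *[rule_format, of "\<lambda>_. x"] .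
    qed
  qed simp
  also have "\<dots> \<longleftrightarrow> norm (T 0 0) \<le> c"
  proof
    assume "norm (T 0 0) \<le> c"
    then have "norm (T 0 0) * norm x \<le> c * norm x" for x :: 'h by (intro mult_right_mono) auto
    then show "\<forall>x. norm (T 0 0 x) \<le> c * norm x" using norm_blinfun order_trans by blast
  qed (use c in \<open>auto intro: norm_blinfun_bound\<close>)
  finally show ?thesis .
qed

text \<open>Adjoints turn the row into a column, \<open>column_approx\<close> moves it into
  \<open>B\<close> at cost 7 g, and adjoints turn it back. Returning to the unit ball costs another
  7 g.\<close>

lemma row_near:
  assumes A: "operator_algebra A e" and B: "operator_algebra B e'"
    and near: "\<And>a. a \<in> A \<Longrightarrow> norm a \<le> 1 \<Longrightarrow> \<exists>b\<in>B. norm b \<le> 1 \<and> norm (a - b) \<le> g"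
    and g: "g > 0" and n: "n \<ge> 1"
    and a: "a \<in> unit_ball (mat_norm n) (row_space n A)"
  shows "\<exists>b\<in>unit_ball (mat_norm n) (row_space n B). mat_norm n (a - b) \<le> 14 * g"
proof -
  interpret A: operator_algebra A e by (rule A)
  interpret B: operator_algebra B e' by (rule B)
  have aA: "a 0 j \<in> A" if "j < n" for j using a that by (simp add: unit_ball_def row_space_def)
  have a0: "a i j = 0" if "i \<noteq> 0" for i j using a that by (simp add: unit_ball_def row_space_def)
  define R where "R = (\<lambda>v. \<Sum>j<n. a 0 j (v j))"
  have "\<forall>v. (norm (R v))\<^sup>2 \<le> 1\<^sup>2 * (\<Sum>j<n. (norm (v j))\<^sup>2)"
    unfolding R_def using a by (subst mat_norm_row_le_iff[OF n a0, symmetric]) (auto simp: unit_ball_def)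
  then have aR: "(norm (R v))\<^sup>2 \<le> 1 * (\<Sum>j<n. (norm (v j))\<^sup>2)" for v by simp
  obtain x where x: "\<And>j. j < n \<Longrightarrow> x j \<in> A" "\<And>j. j < n \<Longrightarrow> adj (a 0 j) (x j)"
    using A.adj_ex[OF aA] by metis
  have "(\<Sum>j<n. (norm (x j v))\<^sup>2) \<le> 1 * (norm v)\<^sup>2" for v
    using row_bound_iff_column_bound[of n "a 0" x 1, OF x(2)] aR unfolding R_def by simp
  then have xb: "(\<Sum>j<n. (norm (x j v))\<^sup>2) \<le> (norm v)\<^sup>2" for v by simp
  obtain y where y: "\<And>j. j < n \<Longrightarrow> y j \<in> B"
      "\<And>v. (\<Sum>j<n. (norm (x j v - y j v))\<^sup>2) \<le> (7 * g)\<^sup>2 * (norm v)\<^sup>2"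
    using column_approx[OF A B near g x(1) xb] by blast
  obtain b where b: "\<And>j. j < n \<Longrightarrow> b j \<in> B" "\<And>j. j < n \<Longrightarrow> adj (y j) (b j)"
    using B.adj_ex[OF y(1)] by metis
  define Q where "Q = (\<lambda>v. \<Sum>j<n. b j (v j))"
  define V where "V = (\<lambda>v. sqrt (\<Sum>j<n. (norm (v j :: 'a))\<^sup>2))"
  have V2: "(\<Sum>j<n. (norm (v j))\<^sup>2) = (V v)\<^sup>2" and V0: "V v \<ge> 0" for v
    unfolding V_def by (simp_all add: sum_nonneg)
  have R1: "norm (R v) \<le> V v" for v
    using aR[of v] V0[of v] unfolding V2 by (simp add: power2_le_iff_abs_le)
  have RQ: "norm (R v - Q v) \<le> 7 * g * V v" for v
  proof -
    have "\<forall>v. (norm (\<Sum>j<n. (a 0 j - b j) (v j)))\<^sup>2 \<le> (7 * g)\<^sup>2 * (\<Sum>j<n. (norm (v j))\<^sup>2)"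
    proof (subst row_bound_iff_column_bound[where S = "\<lambda>j. x j - y j"])
      show "adj (a 0 j - b j) (x j - y j)" if "j < n" for j
        using x(2)[OF that] b(2)[OF that] by (intro adj_diff adj_sym[of "y j"])
      show "\<forall>v. (\<Sum>j<n. (norm ((x j - y j) v))\<^sup>2) \<le> (7 * g)\<^sup>2 * (norm v)\<^sup>2"
        using y(2) by (simp add: blinfun.diff_left)
    qed simp
    then have "(norm (R v - Q v))\<^sup>2 \<le> (7 * g * V v)\<^sup>2"
      unfolding V2 by (simp add: R_def Q_def blinfun.diff_left sum_subtractf power_mult_distrib)
    then show ?thesis by (rule power2_le_imp_le) (use g V0 in auto)
  qed
  have Q1: "norm (Q v) \<le> (1 + 7 * g) * V v" for v
    using norm_triangle_sub[of "Q v" "R v"] R1[of v] RQ[of v]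
    by (simp add: norm_minus_commute algebra_simps)
  \<comment> \<open>The row of the \<open>b j\<close> has norm at most 1 + 7 g. Rescaling by
    \<open>t\<close> makes it a contraction and moves it by at most (1 - t)(1 + 7 g) = 7 g.\<close>
  define t where "t = 1 / (1 + 7 * g)"
  have t: "0 < t" "t < 1" "t * (1 + 7 * g) = 1" using g by (simp_all add: t_def)
  define c where "c = (\<lambda>i j. if i = (0::nat) \<and> j < n then t *\<^sub>R b j else 0)"
  have cQ: "(\<Sum>j<n. c 0 j (v j)) = t *\<^sub>R Q v" for v
    by (simp add: c_def Q_def blinfun.scaleR_left scaleR_sum_right)
  have c1: "mat_norm n c \<le> 1"
  proof (subst mat_norm_row_le_iff[OF n])
    have "norm (t *\<^sub>R Q v) \<le> V v" for v
    proof -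
      have "t * norm (Q v) \<le> t * ((1 + 7 * g) * V v)" using Q1 t by (intro mult_left_mono) auto
      also have "\<dots> = V v" using t(3) by (simp only: mult.assoc[symmetric])
      finally show ?thesis using t by simp
    qed
    then show "\<forall>v. (norm (\<Sum>j<n. c 0 j (v j)))\<^sup>2 \<le> 1\<^sup>2 * (\<Sum>j<n. (norm (v j))\<^sup>2)"
      unfolding cQ V2 by (auto intro!: power_mono simp del: norm_scaleR)
  qed (simp_all add: c_def)
  have ac: "mat_norm n (a - c) \<le> 14 * g"
  proof (subst mat_norm_row_le_iff[OF n])
    have "norm (R v - t *\<^sub>R Q v) \<le> 14 * g * V v" for v
    proof -
      have "R v - t *\<^sub>R Q v = (R v - Q v) + (1 - t) *\<^sub>R Q v"
        by (simp add: scaleR_diff_left)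
      then have "norm (R v - t *\<^sub>R Q v) \<le> norm (R v - Q v) + (1 - t) * norm (Q v)"
        using norm_triangle_ineq[of "R v - Q v" "(1 - t) *\<^sub>R Q v"] t(2) by (metis norm_scaleR abs_of_pos diff_gt_0_iff_gt)
      also have "\<dots> \<le> 7 * g * V v + (1 - t) * ((1 + 7 * g) * V v)"
        using RQ Q1 t by (intro add_mono mult_left_mono) auto
      also have "(1 - t) * ((1 + 7 * g) * V v) = ((1 + 7 * g) - t * (1 + 7 * g)) * V v"
        by (simp add: algebra_simps)
      finally show ?thesis unfolding t(3) by simp
    qed
    moreover have "(\<Sum>j<n. (a - c) 0 j (v j)) = R v - t *\<^sub>R Q v" for v
      unfolding cQ[symmetric] R_def by (simp add: blinfun.diff_left sum_subtractf)
    ultimately show "\<forall>v. (norm (\<Sum>j<n. (a - c) 0 j (v j)))\<^sup>2 \<le> (14 * g)\<^sup>2 * (\<Sum>j<n. (norm (v j))\<^sup>2)"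
      unfolding V2 power_mult_distrib[symmetric] by (simp only: power_mono norm_ge_zero simp_thms)
  qed (use g in \<open>simp_all add: a0 c_def\<close>)
  have "c \<in> unit_ball (mat_norm n) (row_space n B)"
    using c1 b(1) by (simp add: unit_ball_def row_space_def c_def B.scaleR_mem)
  then show ?thesis using ac by blast
qed

section \<open>The Kadison--Kastler distances\<close>

lemma kk_dist_commute:
  assumes "\<And>z. N (- z) = N z"
  shows "kk_dist N X Y = kk_dist N Y X"
proof -
  have "N (x - y) = N (y - x)" for x y using assms[of "x - y"] by simp
  then show ?thesis unfolding kk_dist_def by (subst max.commute) simp
qed

text \<open>Nonnegativity bounds the distances from below, so that each real infimum lies below the
  value at the given witness.\<close>

lemma kk_dist_le:
  assumes zero: "0 \<in> X" "0 \<in> Y" "N 0 \<le> 1"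
    and nonneg: "\<And>x y. x \<in> X \<Longrightarrow> y \<in> Y \<Longrightarrow> 0 \<le> N (x - y)"
    and 1: "\<And>y. y \<in> unit_ball N Y \<Longrightarrow> \<exists>x\<in>unit_ball N X. N (x - y) \<le> c"
    and 2: "\<And>x. x \<in> unit_ball N X \<Longrightarrow> \<exists>y\<in>unit_ball N Y. N (x - y) \<le> c"
  shows "kk_dist N X Y \<le> c"
  unfolding kk_dist_def
proof (intro max.boundedI cSUP_least)
  show "unit_ball N X \<noteq> {}" "unit_ball N Y \<noteq> {}" using zero by (auto simp: unit_ball_def)
  show "(INF x\<in>unit_ball N X. N (x - y)) \<le> c" if "y \<in> unit_ball N Y" for y
  proof -
    have "bdd_below ((\<lambda>x. N (x - y)) ` unit_ball N X)"
      using that by (intro bdd_belowI2[of _ 0] nonneg) (auto simp: unit_ball_def)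
    then show ?thesis using 1[OF that] by (meson cINF_lower2)
  qed
  show "(INF y\<in>unit_ball N Y. N (x - y)) \<le> c" if "x \<in> unit_ball N X" for x
  proof -
    have "bdd_below ((\<lambda>y. N (x - y)) ` unit_ball N Y)"
      using that by (intro bdd_belowI2[of _ 0] nonneg) (auto simp: unit_ball_def)
    then show ?thesis using 2[OF that] by (meson cINF_lower2)
  qed
qed

text \<open>The infimum need not be attained, hence the strict bound \<open>g\<close>. Only the
  direction from X to Y is extracted; \<open>kk_dist_commute\<close> gives the other.\<close>

lemma kk_dist_approx:
  assumes zero: "0 \<in> Y" "N 0 \<le> 1"
    and nonneg: "\<And>x y. x \<in> X \<Longrightarrow> y \<in> Y \<Longrightarrow> 0 \<le> N (x - y)"
    and x: "x \<in> unit_ball N X" and lt: "kk_dist N X Y < g"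
  shows "\<exists>y\<in>unit_ball N Y. N (x - y) < g"
proof -
  have z: "0 \<in> unit_ball N Y" using zero by (simp add: unit_ball_def)
  have bb: "bdd_below ((\<lambda>y. N (x - y)) ` unit_ball N Y)" if "x \<in> unit_ball N X" for x
    using that by (intro bdd_belowI2[of _ 0] nonneg) (auto simp: unit_ball_def)
  have "bdd_above ((\<lambda>x. INF y\<in>unit_ball N Y. N (x - y)) ` unit_ball N X)"
  proof (rule bdd_aboveI2)
    fix x assume x: "x \<in> unit_ball N X"
    then have "N (x - 0) \<le> 1" by (simp add: unit_ball_def)
    then show "(INF y\<in>unit_ball N Y. N (x - y)) \<le> 1" by (rule cINF_lower2[OF bb[OF x] z])
  qed
  then have "(INF y\<in>unit_ball N Y. N (x - y)) \<le> (SUP x\<in>unit_ball N X. INF y\<in>unit_ball N Y. N (x - y))"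
    using x by (intro cSUP_upper)
  also have "\<dots> < g" using lt by (simp add: kk_dist_def)
  finally show ?thesis using z by (subst (asm) cINF_less_iff[OF _ bb[OF x]]) auto
qed

lemma kk_dist_nonneg:
  assumes "0 \<in> X" "0 \<in> Y" "N 0 \<le> 1" "\<And>x y. x \<in> X \<Longrightarrow> y \<in> Y \<Longrightarrow> 0 \<le> N (x - y)"
  shows "0 \<le> kk_dist N X Y"
proof (rule ccontr)
  assume "\<not> 0 \<le> kk_dist N X Y"
  then have "kk_dist N X Y < 0" by simp
  moreover have "0 \<in> unit_ball N X" using assms(1,3) by (simp add: unit_ball_def)
  ultimately obtain y where "y \<in> Y" "N (0 - y) < 0"
    using kk_dist_approx[of Y N X 0 0] assms by (auto simp: unit_ball_def)
  then show False using assms(1,4) by force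
qed

lemma kk_dist_le_1:
  assumes "0 \<in> X" "0 \<in> Y" "N 0 \<le> 1" "\<And>x y. x \<in> X \<Longrightarrow> y \<in> Y \<Longrightarrow> 0 \<le> N (x - y)"
    and "\<And>z. N (- z) = N z"
  shows "kk_dist N X Y \<le> 1"
  using assms by (intro kk_dist_le) (auto simp: unit_ball_def intro!: bexI[of _ 0])

section \<open>Comparison of the distance with the row distance\<close>

lemma zero_mem_row_space: "0 \<in> X \<Longrightarrow> 0 \<in> row_space n X"
  by (simp add: row_space_def)

lemma row_space_zero: "T \<in> row_space n X \<Longrightarrow> i \<noteq> 0 \<Longrightarrow> T i j = 0"
  by (simp add: row_space_def)

lemma mat_norm_row_space_diff_nonneg:
  assumes "n \<ge> 1" "S \<in> row_space n X" "T \<in> row_space n Y"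
  shows "0 \<le> mat_norm n (S - T)"
  using assms by (intro mat_norm_nonneg) (auto simp: row_space_zero)

text \<open>Operators are rows of length 1, so the distance is bounded by the term n = 1 of the
  supremum.\<close>

lemma d_KK_le_d_row:
  assumes "0 \<in> A" "0 \<in> B"
  shows "d_KK A B \<le> d_row A B"
proof -
  let ?k = "\<lambda>n. kk_dist (mat_norm n) (row_space n A) (row_space n B)"
  have half: "\<exists>y\<in>unit_ball norm Y. norm (x - y) \<le> g"
    if XY: "0 \<in> X" "0 \<in> Y" and x: "x \<in> unit_ball norm X"
      and lt: "kk_dist (mat_norm 1) (row_space 1 X) (row_space 1 Y) < g"
    for X Y :: "('a \<Rightarrow>\<^sub>L 'a) set" and x g
  proof -
    define S where "S = (\<lambda>i j::nat. if i = (0::nat) \<and> j = 0 then x else 0)"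
    have S: "S \<in> row_space 1 X" using x by (simp add: row_space_def S_def unit_ball_def)
    have "mat_norm 1 S \<le> 1" using x by (subst mat_norm_one_le_iff) (auto simp: S_def unit_ball_def)
    then obtain T where T: "T \<in> row_space 1 Y" "mat_norm 1 T \<le> 1" "mat_norm 1 (S - T) < g"
      using kk_dist_approx[of "row_space 1 Y" "mat_norm 1" "row_space 1 X" S g] XY lt S
      by (auto simp: unit_ball_def zero_mem_row_space mat_norm_zero_le mat_norm_row_space_diff_nonneg)
    have "0 \<le> mat_norm 1 (S - T)" using S T(1) by (intro mat_norm_row_space_diff_nonneg) auto
    then have g: "0 \<le> g" using T(3) by simp
    have "norm (T 0 0) \<le> 1" using T(1,2) by (subst (asm) mat_norm_one_le_iff) (auto simp: row_space_zero)
    moreover have "norm ((S - T) 0 0) \<le> g"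
      using T(1,3) S g by (subst mat_norm_one_le_iff[symmetric]) (auto simp: row_space_zero)
    ultimately show ?thesis
      using T(1) by (intro bexI[of _ "T 0 0"]) (auto simp: S_def unit_ball_def row_space_def)
  qed
  have "d_KK A B \<le> ?k 1"
  proof (rule dense_ge)
    fix g assume g: "?k 1 < g"
    have g': "kk_dist (mat_norm 1) (row_space 1 B) (row_space 1 A) < g"
      using g by (subst kk_dist_commute) (auto simp: mat_norm_uminus)
    show "d_KK A B \<le> g"
      unfolding d_KK_def
    proof (rule kk_dist_le)
      show "\<exists>x\<in>unit_ball norm A. norm (x - y) \<le> g" if "y \<in> unit_ball norm B" for y
        using half[OF assms(2,1) that g'] by (simp add: norm_minus_commute)
    qed (use assms half[OF assms _ g] in auto)
  qed
  also have "\<dots> \<le> d_row A B"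
    unfolding d_row_def
  proof (rule cSUP_upper)
    \<comment> \<open>Comparing with the zero row bounds every term by 1, so the supremum dominates
      its term n = 1.\<close>
    show "bdd_above (?k ` {1..})"
      using assms
      by (intro bdd_aboveI2[of _ _ 1] kk_dist_le_1)
        (auto simp: zero_mem_row_space mat_norm_zero_le mat_norm_row_space_diff_nonneg mat_norm_uminus)
  qed simp
  finally show ?thesis .
qed

lemma d_row_le_d_KK:
  assumes "operator_algebra A e" "operator_algebra B e'"
  shows "d_row A B \<le> 14 * d_KK A B"
proof -
  interpret A: operator_algebra A e by (rule assms)
  interpret B: operator_algebra B e' by (rule assms)
  have "kk_dist (mat_norm n) (row_space n A) (row_space n B) \<le> 14 * d_KK A B" if n: "n \<ge> 1" for n
  proof -
    let ?k = "kk_dist (mat_norm n) (row_space n A) (row_space n B)"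
    \<comment> \<open>Working with every g above the distance avoids unattained infima and keeps g
      positive even when the distance is 0.\<close>
    have "?k / 14 \<le> d_KK A B"
    proof (rule dense_ge)
      fix g assume g: "d_KK A B < g"
      have "0 \<le> d_KK A B"
        unfolding d_KK_def by (rule kk_dist_nonneg) (auto simp: A.zero_mem B.zero_mem)
      then have g0: "0 < g" using g by simp
      have g': "d_KK B A < g" using g unfolding d_KK_def by (subst kk_dist_commute) auto
      have AB: "\<exists>b\<in>B. norm b \<le> 1 \<and> norm (a - b) \<le> g" if "a \<in> A" "norm a \<le> 1" for a
        using kk_dist_approx[of B norm A a g] that g B.zero_mem
        unfolding d_KK_def unit_ball_def by fastforce
      have BA: "\<exists>b\<in>A. norm b \<le> 1 \<and> norm (a - b) \<le> g" if "a \<in> B" "norm a \<le> 1" for a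
        using kk_dist_approx[of A norm B a g] that g' A.zero_mem
        unfolding d_KK_def unit_ball_def by fastforce
      have "?k \<le> 14 * g"
      proof (rule kk_dist_le)
        fix y assume "y \<in> unit_ball (mat_norm n) (row_space n B)"
        then obtain x where "x \<in> unit_ball (mat_norm n) (row_space n A)" "mat_norm n (y - x) \<le> 14 * g"
          using row_near[OF assms(2,1) BA g0 n] by blast
        then show "\<exists>x\<in>unit_ball (mat_norm n) (row_space n A). mat_norm n (x - y) \<le> 14 * g"
          by (metis minus_diff_eq mat_norm_uminus)
      next
        fix x assume "x \<in> unit_ball (mat_norm n) (row_space n A)"
        then show "\<exists>y\<in>unit_ball (mat_norm n) (row_space n B). mat_norm n (x - y) \<le> 14 * g"
          using row_near[OF assms AB g0 n] by blast
      qed (use n in \<open>auto simp: zero_mem_row_space A.zero_mem B.zero_mem mat_norm_zero_le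
          mat_norm_row_space_diff_nonneg\<close>)
      then show "?k / 14 \<le> g" by simp
    qed
    then show ?thesis by simp
  qed
  then show ?thesis unfolding d_row_def by (intro cSUP_least) auto
qed

theorem theorem2p11:
  "equivalent_dists_on
     {A :: ('h::complex_hilbert_space \<Rightarrow>\<^sub>L 'h) set. unital_cstar_subalgebra A} d_KK d_row \<and>
   (\<forall>(A :: ('h \<Rightarrow>\<^sub>L 'h) set) B.
      unital_cstar_subalgebra A \<longrightarrow> unital_cstar_subalgebra B \<longrightarrow>
      d_row A B \<le> 220 * d_KK A B)"
proof -
  have main: "d_KK A B \<le> 1 * d_row A B \<and> d_row A B \<le> 220 * d_KK A B"
    if AB: "unital_cstar_subalgebra A" "unital_cstar_subalgebra B" for A B :: "('h \<Rightarrow>\<^sub>L 'h) set"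
  proof -
    obtain e e' where e: "operator_algebra A e" "operator_algebra B e'"
      using AB unital_cstar_subalgebra_operator_algebra by metis
    have zero: "0 \<in> A" "0 \<in> B" using e by (auto dest: operator_algebra.zero_mem)
    \<comment> \<open>Nonnegativity lets the constant 14 be weakened to 220.\<close>
    have "0 \<le> d_KK A B" unfolding d_KK_def by (rule kk_dist_nonneg) (auto simp: zero)
    then show ?thesis using d_KK_le_d_row[OF zero] d_row_le_d_KK[OF e] by simp
  qed
  show ?thesis
    unfolding equivalent_dists_on_def
    by (intro conjI exI[of _ "1::real"] exI[of _ "220::real"]) (use main in auto)
qed

end
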